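(* Let $(a,b)\in\mathbb{Q}^2\setminus\mathbb{Z}^2$, $f=[(a,b)+\mathbb{Z}^2]$, and let $\gamma=\begin{bmatrix}\alpha&x\\\beta&y\end{bmatrix}\in\mathrm{SL}_2(\mathbb{Z})$ with $\beta>0$, so $\gamma\cdot i\infty=\alpha/\beta$. Then \[\frac{1}{2\pi i}\int_{\alpha/\beta}^{i\infty}\mathrm{dlog}(u(f))=C(\alpha,\beta,a,b)-\frac{1}{2\pi i}\big((\delta_0\otimes\mathrm{RClog})(f|\gamma)-(\delta_0\otimes\mathrm{RClog})(f)\big).\]
   Context: $q^y=e^{2\pi i y\tau}$, $\zeta^x=e^{2\pi ix}$. For $(a,b)\notin\mathbb{Z}^2$, $u(f)$ is the nowhere vanishing holomorphic function on the upper half plane $u(f)(\tau)=\prod_{y\in\mathbb{Q},\,y>0,\,y\equiv a\ (\mathrm{mod}\ \mathbb{Z})}(1-q^y\zeta^b)\prod_{y<0,\,y\equiv a\ (\mathrm{mod}\ \mathbb{Z})}(1-q^{-y}\zeta^{-b})$, and $\mathrm{dlog}(u(f))=u(f)'/u(f)\,d\tau$. The integral is along the vertical path $\alpha/\beta+it$, $t\ge0$. $(f|\gamma)(v)=f(v\gamma^{-1})$, so $f|\gamma=[(a,b)\gamma+\mathbb{Z}^2]=[(a\alpha+b\beta,ax+by)+\mathbb{Z}^2]$. For $g=[(a',b')+\mathbb{Z}^2]$ with $(a',b')\notin\mathbb{Z}^2$: $(\delta_0\otimes\mathrm{RClog})(g)=\delta_0(a')\log|1-e^{2\pi ib'}|$,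 where $\delta_0(x)=1$ if $x\in\mathbb{Z}$ and $0$ otherwise. $\mathbb{B}_1(x)=x-\lfloor x\rfloor-\frac12$ for $x\notin\mathbb{Z}$ and $\mathbb{B}_1(x)=0$ for $x\in\mathbb{Z}$. The Dedekind sum is $C(\alpha,\beta,a,b)=\sum_{\ell=0}^{\beta-1}\mathbb{B}_1\big(\tfrac{a+\ell}{\beta}\big)\mathbb{B}_1\big(b+\tfrac{\alpha}{\beta}(a+\ell)\big)$.
   Formalization: The integral from α/β to i∞ diverges at α/β for every admissible (a,b) and γ (dlog u(f) grows like a nonzero constant times dt/t²), so it is read as Hadamard's finite part: the constant term of the integral over t ≥ ε as ε → 0, whose existence is also proved. *)

theory Defs
  imports "HOL-Analysis.Analysis" "HOL-Real_Asymp.Real_Asymp"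
begin

section \<open>Characteristic functions of cosets of \<open>\<int>\<^sup>2\<close> in \<open>\<rat>\<^sup>2\<close>\<close>

definition coset_fun :: "rat \<times> rat \<Rightarrow> rat \<times> rat \<Rightarrow> int" where
  "coset_fun w = indicator {v. fst v - fst w \<in> \<int> \<and> snd v - snd w \<in> \<int>}"

text \<open>The function \<open>v \<mapsto> f (v \<gamma>\<^sup>-\<^sup>1)\<close> for the row vector \<open>v\<close> and the matrix \<open>\<gamma>\<close> of determinant 1
  with rows \<open>(\<alpha>, x)\<close> and \<open>(\<beta>, y)\<close>, whose inverse has rows \<open>(y, -x)\<close> and \<open>(-\<beta>, \<alpha>)\<close>.\<close>

definition slash :: "(rat \<times> rat \<Rightarrow> int) \<Rightarrow> int \<Rightarrow> int \<Rightarrow> int \<Rightarrow> int \<Rightarrow> rat \<times> rat \<Rightarrow> int" where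
  "slash f \<alpha> x \<beta> y =
     (\<lambda>(v1, v2). f (v1 * of_int y - v2 * of_int \<beta>, v2 * of_int \<alpha> - v1 * of_int x))"

lemma coset_fun_eqD:
  assumes "coset_fun (a, b) = coset_fun (a', b')"
  shows "a - a' \<in> \<int>" "b - b' \<in> \<int>"
proof -
  have "coset_fun (a', b') (a, b) = 1"
    using assms[symmetric] by (simp add: coset_fun_def)
  thus "a - a' \<in> \<int>" "b - b' \<in> \<int>"
    by (auto simp: coset_fun_def indicator_def split: if_splits)
qed

lemma slash_coset_fun:
  assumes "\<alpha> * y - x * \<beta> = 1"
  shows "slash (coset_fun (a, b)) \<alpha> x \<beta> y =
    coset_fun (a * of_int \<alpha> + b * of_int \<beta>, a * of_int x + b * of_int y)"
proof (rule ext, clarify)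
  fix v w :: rat
  define A X B Y :: rat where "A = of_int \<alpha>" and "X = of_int x" and "B = of_int \<beta>" and "Y = of_int y"
  have Z: "A \<in> \<int>" "X \<in> \<int>" "B \<in> \<int>" "Y \<in> \<int>"
    by (simp_all add: A_def X_def B_def Y_def)
  have det: "A * Y - X * B = 1"
    using arg_cong[OF assms, of "of_int :: int \<Rightarrow> rat"]
    by (simp add: A_def X_def B_def Y_def)
  define s t where "s = v * Y - w * B - a" and "t = w * A - v * X - b"
  define s' t' where "s' = v - (a * A + b * B)" and "t' = w - (a * X + b * Y)"
  have 1: "s' = s * A + t * B" "t' = s * X + t * Y"
    unfolding s_def t_def s'_def t'_def using det by algebra+
  have 2: "s = s' * Y - t' * B" "t = t' * A - s' * X"
    unfolding s_def t_def s'_def t'_def using det by algebra+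
  have "s \<in> \<int> \<and> t \<in> \<int> \<longleftrightarrow> s' \<in> \<int> \<and> t' \<in> \<int>"
    by (metis 1 2 Z Ints_add Ints_diff Ints_mult)
  thus "slash (coset_fun (a, b)) \<alpha> x \<beta> y (v, w) =
      coset_fun (a * of_int \<alpha> + b * of_int \<beta>, a * of_int x + b * of_int y) (v, w)"
    by (simp add: slash_def coset_fun_def indicator_def s_def t_def s'_def t'_def
                  A_def X_def B_def Y_def)
qed

section \<open>The functions \<open>u(f)\<close>\<close>

definition qpow :: "rat \<Rightarrow> complex \<Rightarrow> complex" where
  "qpow y \<tau> = exp (2 * of_real pi * \<i> * of_rat y * \<tau>)"

definition zpow :: "rat \<Rightarrow> complex" where
  "zpow x = exp (2 * of_real pi * \<i> * of_rat x)"

text \<open>The representative of \<open>a\<close> modulo \<open>\<int>\<close> in the interval \<open>(0, 1]\<close>.\<close>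

definition pos_rep :: "rat \<Rightarrow> rat" where
  "pos_rep a = a - of_int \<lceil>a\<rceil> + 1"

lemma bij_betw_pos_rep:
  "bij_betw (\<lambda>n. pos_rep a + of_nat n) UNIV {y. 0 < y \<and> y - a \<in> \<int>}"
proof (rule bij_betwI')
  fix n :: nat
  have "0 < pos_rep a"
    unfolding pos_rep_def by linarith
  hence "0 < pos_rep a + of_nat n"
    by (simp add: add_pos_nonneg)
  moreover have "pos_rep a + of_nat n - a \<in> \<int>"
    by (simp add: pos_rep_def)
  ultimately show "pos_rep a + of_nat n \<in> {y. 0 < y \<and> y - a \<in> \<int>}"
    by simp
next
  fix y assume "y \<in> {y. 0 < y \<and> y - a \<in> \<int>}"
  then obtain k where k: "y = a + of_int k" and y: "0 < y"
    by (auto elim!: Ints_cases simp: algebra_simps)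
  have "\<lceil>a\<rceil> - 1 + k \<ge> 0"
    using k y by linarith
  hence "of_nat (nat (\<lceil>a\<rceil> - 1 + k)) = (of_int (\<lceil>a\<rceil> - 1 + k) :: rat)"
    by simp
  hence "y = pos_rep a + of_nat (nat (\<lceil>a\<rceil> - 1 + k))"
    using k by (simp add: pos_rep_def)
  thus "\<exists>n\<in>UNIV. y = pos_rep a + of_nat n"
    by blast
qed auto

text \<open>The second product is indexed by the values \<open>-y > 0\<close>, which run through the positive
  elements of \<open>-a + \<int>\<close>.\<close>

definition u_prod :: "rat \<Rightarrow> rat \<Rightarrow> complex \<Rightarrow> complex" where
  "u_prod a b \<tau> =
     (\<Prod>n. 1 - qpow (pos_rep a + of_nat n) \<tau> * zpow b) *
     (\<Prod>n. 1 - qpow (pos_rep (-a) + of_nat n) \<tau> * zpow (-b))"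

definition u :: "(rat \<times> rat \<Rightarrow> int) \<Rightarrow> complex \<Rightarrow> complex" where
  "u f = (THE w. \<exists>a b. f = coset_fun (a, b) \<and> w = u_prod a b)"

definition dlog :: "(complex \<Rightarrow> complex) \<Rightarrow> complex \<Rightarrow> complex" where
  "dlog g \<tau> = deriv g \<tau> / g \<tau>"

lemma pos_rep_cong:
  assumes "a - a' \<in> \<int>"
  shows "pos_rep a = pos_rep a'"
proof -
  obtain k where "a = a' + of_int k"
    using assms by (auto elim!: Ints_cases simp: algebra_simps)
  thus ?thesis by (simp add: pos_rep_def)
qed

lemma zpow_cong:
  assumes "b - b' \<in> \<int>"
  shows "zpow b = zpow b'"
proof -
  obtain k where "b = b' + of_int k"
    using assms by (auto elim!: Ints_cases simp: algebra_simps)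
  hence "zpow b = zpow b' * exp (2 * of_real pi * \<i> * of_int k)"
    by (simp add: zpow_def of_rat_add exp_add ring_distribs)
  also have "exp (2 * of_real pi * \<i> * of_int k) = (1 :: complex)"
    using exp_integer_2pi[of "of_int k"] by (simp add: mult_ac)
  finally show ?thesis by simp
qed

lemma u_coset_fun: "u (coset_fun (a, b)) = u_prod a b"
  unfolding u_def
proof (rule the_equality)
  fix w assume "\<exists>a' b'. coset_fun (a, b) = coset_fun (a', b') \<and> w = u_prod a' b'"
  then obtain a' b' where eq: "coset_fun (a, b) = coset_fun (a', b')" and w: "w = u_prod a' b'"
    by blast
  note Z = coset_fun_eqD[OF eq]
  have "(-a) - (-a') \<in> \<int>" "(-b) - (-b') \<in> \<int>"
    using Z by (metis Ints_minus minus_diff_minus)+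
  thus "w = u_prod a b"
    using Z w by (intro ext) (simp add: u_prod_def pos_rep_cong[of a a'] pos_rep_cong[of "-a" "-a'"]
      zpow_cong[of b b'] zpow_cong[of "-b" "-b'"])
qed blast

section \<open>The boundary term \<open>\<delta>\<^sub>0 \<otimes> RClog\<close>\<close>

definition delta0 :: "rat \<Rightarrow> real" where
  "delta0 x = (if x \<in> \<int> then 1 else 0)"

definition delta0_RClog :: "(rat \<times> rat \<Rightarrow> int) \<Rightarrow> real" where
  "delta0_RClog g =
     (THE r. \<exists>a b. g = coset_fun (a, b) \<and> r = delta0 a * ln (cmod (1 - zpow b)))"

lemma delta0_RClog_coset_fun:
  "delta0_RClog (coset_fun (a, b)) = delta0 a * ln (cmod (1 - zpow b))"
  unfolding delta0_RClog_def
proof (rule the_equality)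
  fix r
  assume "\<exists>a' b'. coset_fun (a, b) = coset_fun (a', b') \<and>
            r = delta0 a' * ln (cmod (1 - zpow b'))"
  then obtain a' b' where eq: "coset_fun (a, b) = coset_fun (a', b')"
      and r: "r = delta0 a' * ln (cmod (1 - zpow b'))"
    by blast
  note Z = coset_fun_eqD[OF eq]
  have "a \<in> \<int> \<longleftrightarrow> a' \<in> \<int>"
    using Z(1) by (metis Ints_add Ints_diff diff_add_cancel diff_diff_eq2 add_diff_cancel_left')
  thus "r = delta0 a * ln (cmod (1 - zpow b))"
    using r zpow_cong[OF Z(2)] by (simp add: delta0_def)
qed blast

section \<open>Dedekind sums\<close>

definition B1 :: "rat \<Rightarrow> rat" where
  "B1 x = (if x \<in> \<int> then 0 else x - of_int \<lfloor>x\<rfloor> - 1 / 2)"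

definition dedekind_sum :: "int \<Rightarrow> int \<Rightarrow> rat \<Rightarrow> rat \<Rightarrow> rat" where
  "dedekind_sum \<alpha> \<beta> a b =
     (\<Sum>l = 0..\<beta> - 1. B1 ((a + of_int l) / of_int \<beta>) *
        B1 (b + of_int \<alpha> / of_int \<beta> * (a + of_int l)))"

section \<open>The regularized integral from a cusp to \<open>i\<infinity>\<close>\<close>

text \<open>On the path \<open>\<tau> = \<alpha>/\<beta> + i t\<close> the form \<open>dlog u(f)\<close> decays exponentially as \<open>t\<close> tends to
  infinity, but it behaves like a non-zero constant times \<open>dt / t\<^sup>2\<close> as \<open>t\<close> tends to 0:
  the constant is a non-zero multiple of the value of the second Bernoulli polynomial at the
  fractional part of \<open>a \<alpha> + b \<beta>\<close>, and that polynomial has no rational root.  The integral is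
  therefore understood as Hadamard's finite part, that is, the constant term in the expansion of
  the integral over \<open>[\<epsilon>, \<infinity>)\<close> in negative powers of \<open>\<epsilon>\<close> and \<open>ln \<epsilon>\<close>.  It is unique if it exists,
  and it is the ordinary improper integral if that converges.\<close>

definition has_fp_integral :: "(real \<Rightarrow> complex) \<Rightarrow> complex \<Rightarrow> bool" where
  "has_fp_integral \<phi> L \<longleftrightarrow>
     (\<forall>\<epsilon>>0. \<phi> absolutely_integrable_on {\<epsilon>..}) \<and>
     (\<exists>\<Lambda> c k. finite \<Lambda> \<and> \<Lambda> \<subseteq> {0<..} \<and>
        ((\<lambda>\<epsilon>. integral {\<epsilon>..} \<phi> -
              ((\<Sum>s\<in>\<Lambda>. c s * of_real (\<epsilon> powr (-s))) + k * of_real (ln \<epsilon>))) \<longlongrightarrow> L) (at_right 0))"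

definition fp_integrable :: "(real \<Rightarrow> complex) \<Rightarrow> bool" where
  "fp_integrable \<phi> \<longleftrightarrow> (\<exists>L. has_fp_integral \<phi> L)"

definition fp_integral :: "(real \<Rightarrow> complex) \<Rightarrow> complex" where
  "fp_integral \<phi> = (THE L. has_fp_integral \<phi> L)"

text \<open>The pullback of the differential \<open>g(\<tau>) d\<tau>\<close> to the path \<open>\<tau> = r + i t\<close>.\<close>

definition vertical_pullback :: "(complex \<Rightarrow> complex) \<Rightarrow> real \<Rightarrow> real \<Rightarrow> complex" where
  "vertical_pullback g r t = g (of_real r + \<i> * of_real t) * \<i>"

lemma divergent_expansion_limit:
  fixes c :: "real \<Rightarrow> complex" and k d :: complex
  assumes "finite \<Lambda>" "\<Lambda> \<subseteq> {0<..}"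
    and "((\<lambda>\<epsilon>. (\<Sum>s\<in>\<Lambda>. c s * of_real (\<epsilon> powr (-s))) + k * of_real (ln \<epsilon>)) \<longlongrightarrow> d)
           (at_right 0)"
  shows "d = 0"
  using assms
proof (induction \<Lambda> rule: finite_linorder_max_induct)
  case empty
  show ?case
  proof (cases "k = 0")
    case True
    thus ?thesis using empty.prems(2) by (simp add: tendsto_const_iff)
  next
    case False
    have "((\<lambda>\<epsilon>. k * of_real (ln \<epsilon>)) \<longlongrightarrow> d) (at_right 0)"
      using empty.prems(2) by simp
    from tendsto_Re[OF tendsto_mult[OF tendsto_const[of "inverse k"] this]]
    have "((\<lambda>\<epsilon>::real. ln \<epsilon>) \<longlongrightarrow> Re (inverse k * d)) (at_right 0)"
      using False by (simp add: mult.assoc[symmetric])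
    moreover have "filterlim (\<lambda>\<epsilon>::real. ln \<epsilon>) at_bot (at_right 0)"
      by (rule ln_at_0)
    ultimately show ?thesis
      using not_tendsto_and_filterlim_at_infinity[of "at_right (0::real)" ln]
        filterlim_mono[OF _ at_bot_le_at_infinity order.refl] by fastforce
  qed
next
  case (insert \<mu> \<Lambda>)
  have \<mu>: "\<mu> > 0" and \<Lambda>: "\<Lambda> \<subseteq> {0<..}" and notin: "\<mu> \<notin> \<Lambda>"
    using insert by auto
  define F where "F = (\<lambda>\<epsilon>. (\<Sum>s\<in>insert \<mu> \<Lambda>. c s * of_real (\<epsilon> powr (-s))) + k * of_real (ln \<epsilon>))"
  have lim0: "((\<lambda>\<epsilon>::real. \<epsilon> powr e) \<longlongrightarrow> 0) (at_right 0)" if "e > 0" for e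
    using that by real_asymp
  have limln: "((\<lambda>\<epsilon>::real. \<epsilon> powr \<mu> * ln \<epsilon>) \<longlongrightarrow> 0) (at_right 0)"
    using \<mu> by real_asymp
  have "((\<lambda>\<epsilon>. of_real (\<epsilon> powr \<mu>) * F \<epsilon>) \<longlongrightarrow> of_real 0 * d) (at_right 0)"
    unfolding F_def using insert.prems(2) lim0[OF \<mu>] by (intro tendsto_mult tendsto_of_real)
  moreover have "((\<lambda>\<epsilon>. of_real (\<epsilon> powr \<mu>) * F \<epsilon>) \<longlongrightarrow> c \<mu>) (at_right 0)"
  proof (rule Lim_transform_eventually)
    have "((\<lambda>\<epsilon>. c \<mu> + (\<Sum>s\<in>\<Lambda>. c s * of_real (\<epsilon> powr (\<mu> - s))) + k * of_real (\<epsilon> powr \<mu> * ln \<epsilon>))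
        \<longlongrightarrow> c \<mu> + (\<Sum>s\<in>\<Lambda>. c s * of_real 0) + k * of_real 0) (at_right 0)"
      using insert.hyps by (intro tendsto_intros lim0 limln) auto
    thus "((\<lambda>\<epsilon>. c \<mu> + (\<Sum>s\<in>\<Lambda>. c s * of_real (\<epsilon> powr (\<mu> - s))) + k * of_real (\<epsilon> powr \<mu> * ln \<epsilon>))
        \<longlongrightarrow> c \<mu>) (at_right 0)"
      by simp
    show "\<forall>\<^sub>F \<epsilon> in at_right 0.
        c \<mu> + (\<Sum>s\<in>\<Lambda>. c s * of_real (\<epsilon> powr (\<mu> - s))) + k * of_real (\<epsilon> powr \<mu> * ln \<epsilon>) =
        of_real (\<epsilon> powr \<mu>) * F \<epsilon>"
      using eventually_at_right_less[of "0::real"]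
    proof eventually_elim
      case (elim \<epsilon>)
      have *: "complex_of_real (\<epsilon> powr \<mu>) * (c s * of_real (\<epsilon> powr (-s))) =
          c s * of_real (\<epsilon> powr (\<mu> - s))" for s
      proof -
        have "\<epsilon> powr (\<mu> - s) = \<epsilon> powr \<mu> * \<epsilon> powr (-s)"
          by (simp flip: powr_add)
        thus ?thesis by simp
      qed
      have "of_real (\<epsilon> powr \<mu>) * F \<epsilon> =
          (\<Sum>s\<in>insert \<mu> \<Lambda>. c s * of_real (\<epsilon> powr (\<mu> - s))) + k * of_real (\<epsilon> powr \<mu> * ln \<epsilon>)"
        unfolding F_def distrib_left sum_distrib_left * by simp
      also have "\<dots> = c \<mu> + (\<Sum>s\<in>\<Lambda>. c s * of_real (\<epsilon> powr (\<mu> - s))) +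
          k * of_real (\<epsilon> powr \<mu> * ln \<epsilon>)"
        using insert.hyps(1) notin elim by simp
      finally show ?case by simp
    qed
  qed
  ultimately have "c \<mu> = 0"
    using tendsto_unique[of "at_right (0::real)"] by fastforce
  thus ?case
    using insert.IH[OF \<Lambda>] insert.prems(2) insert.hyps(1) notin by simp
qed

lemma has_fp_integral_unique:
  assumes "has_fp_integral \<phi> L" "has_fp_integral \<phi> L'"
  shows "L = L'"
proof -
  obtain \<Lambda> c k where 1: "finite \<Lambda>" "\<Lambda> \<subseteq> {0<..}"
    "((\<lambda>\<epsilon>. integral {\<epsilon>..} \<phi> -
        ((\<Sum>s\<in>\<Lambda>. c s * of_real (\<epsilon> powr (-s))) + k * of_real (ln \<epsilon>))) \<longlongrightarrow> L) (at_right 0)"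
    using assms(1) unfolding has_fp_integral_def by blast
  obtain \<Lambda>' c' k' where 2: "finite \<Lambda>'" "\<Lambda>' \<subseteq> {0<..}"
    "((\<lambda>\<epsilon>. integral {\<epsilon>..} \<phi> -
        ((\<Sum>s\<in>\<Lambda>'. c' s * of_real (\<epsilon> powr (-s))) + k' * of_real (ln \<epsilon>))) \<longlongrightarrow> L') (at_right 0)"
    using assms(2) unfolding has_fp_integral_def by blast
  define C where "C = (\<lambda>s. (if s \<in> \<Lambda>' then c' s else 0) - (if s \<in> \<Lambda> then c s else 0))"
  have ext: "(\<Sum>s\<in>\<Lambda> \<union> \<Lambda>'. (if s \<in> M then e s else 0) * g s) = (\<Sum>s\<in>M. e s * g s)"
    if "M \<subseteq> \<Lambda> \<union> \<Lambda>'" for M and e g :: "real \<Rightarrow> complex"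
    using that 1(1) 2(1) by (intro sum.mono_neutral_cong_right) auto
  have C: "(\<Sum>s\<in>\<Lambda> \<union> \<Lambda>'. C s * g s) = (\<Sum>s\<in>\<Lambda>'. c' s * g s) - (\<Sum>s\<in>\<Lambda>. c s * g s)" for g
    unfolding C_def left_diff_distrib sum_subtractf by (simp add: ext)
  have "((\<lambda>\<epsilon>. (\<Sum>s\<in>\<Lambda> \<union> \<Lambda>'. C s * of_real (\<epsilon> powr (-s))) + (k' - k) * of_real (ln \<epsilon>))
      \<longlongrightarrow> L - L') (at_right 0)"
    using tendsto_diff[OF 1(3) 2(3)] unfolding C by (simp add: algebra_simps)
  from divergent_expansion_limit[OF _ _ this] 1(1,2) 2(1,2) show ?thesis
    by simp
qed

lemma fp_integral_eqI: "has_fp_integral \<phi> L \<Longrightarrow> fp_integral \<phi> = L"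
  unfolding fp_integral_def by (blast intro: has_fp_integral_unique)

end

theory Submission
  imports Defs "HOL-Complex_Analysis.Complex_Analysis"
begin

text \<open>
  Let \<open>L(c, x, w) = log (\<Prod>k\<ge>0. 1 - c exp (-(x + k) w))\<close>.  Expanding the logarithms and summing over
  \<open>k\<close> first turns \<open>L\<close> into the Lambert series
  \<open>- \<Sum>m\<ge>1. c\<^sup>m / m * exp (-m x w) / (1 - exp (-m w))\<close>.  The logarithm of \<open>u(f)\<close> is a sum of two such
  series and vanishes at \<open>i\<infinity>\<close>, so the integral from \<open>\<alpha>/\<beta> + i\<epsilon>\<close> to \<open>i\<infinity>\<close> is minus its value at
  \<open>\<alpha>/\<beta> + i\<epsilon>\<close>.  There, splitting the factors by their index modulo \<open>\<beta>\<close> leaves terms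
  \<open>L(exp (2\<pi>i\<theta>), y/\<beta>, s)\<close> with \<open>s = 2\<pi>\<beta>\<epsilon>\<close>, which come in pairs \<open>(y/\<beta>, \<theta>)\<close>, \<open>(1 - y/\<beta>, -\<theta>)\<close>.

  For \<open>c \<noteq> 1\<close> an Abelian theorem for monotone kernels gives
  \<open>L(c, x, s) = - Li\<^sub>2(c)/s + (1/2 - x) Log (1 - c) + o(1)\<close>.  Since
  \<open>Im Log (1 - exp (2\<pi>i\<theta>)) = \<pi> B\<^sub>1(\<theta>)\<close>, a pair contributes \<open>-2\<pi>i B\<^sub>1(y/\<beta>) B\<^sub>1(\<theta>)\<close>, a term of
  the Dedekind sum.  For \<open>c = 1\<close> the sine product compares a pair with \<open>2 L(1, 1, s)\<close>, whose
  constant term follows from the duplication formula and the leading term \<open>- Li\<^sub>2(1)/s\<close> alone;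
  the pair contributes \<open>log (2 sin (\<pi>y/\<beta>))\<close>.  It occurs exactly if \<open>a\<alpha> + b\<beta>\<close> is an integer and is
  the boundary term at \<open>\<alpha>/\<beta>\<close>.  The unpaired factors with \<open>y = \<beta>\<close>, which occur exactly if \<open>a\<close> is an
  integer, give the boundary term at \<open>i\<infinity>\<close>.
\<close>

section \<open>Summation by parts\<close>

lemma
  fixes a :: "nat \<Rightarrow> 'a::banach" and b :: "nat \<Rightarrow> real"
  assumes bounded: "\<And>n. norm (\<Sum>k<n. a k) \<le> B" and decseq: "decseq b" and lim: "b \<longlonglongrightarrow> 0"
  shows summable_Dirichlet_test: "summable (\<lambda>n. (b n - b (Suc n)) *\<^sub>R (\<Sum>k\<le>n. a k))"
    and sums_Dirichlet_test: "(\<lambda>n. b n *\<^sub>R a n) sums (\<Sum>n. (b n - b (Suc n)) *\<^sub>R (\<Sum>k\<le>n. a k))"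
proof -
  show summable: "summable (\<lambda>n. (b n - b (Suc n)) *\<^sub>R (\<Sum>k\<le>n. a k))"
  proof (rule summable_comparison_test')
    show "summable (\<lambda>n. (b n - b (Suc n)) * B)"
      using telescope_sums'[OF lim] by (intro summable_mult2) (simp add: sums_iff)
    show "norm ((b n - b (Suc n)) *\<^sub>R (\<Sum>k\<le>n. a k)) \<le> (b n - b (Suc n)) * B" for n
      using bounded[of "Suc n"] decseq_SucD[OF decseq, of n]
      by (simp add: mult_left_mono lessThan_Suc_atMost)
  qed
  have by_parts: "(\<Sum>n<N. (b n - b (Suc n)) *\<^sub>R (\<Sum>k\<le>n. a k)) + b N *\<^sub>R (\<Sum>k<N. a k) =
      (\<Sum>n<N. b n *\<^sub>R a n)" for N
  proof (induction N)
    case (Suc N)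
    then show ?case
      by (simp add: algebra_simps flip: lessThan_Suc_atMost)
  qed simp
  have "(\<lambda>N. b N *\<^sub>R (\<Sum>k<N. a k)) \<longlonglongrightarrow> 0"
    by (rule tendsto_0_le[OF lim, where K = B])
       (use bounded in \<open>auto intro!: always_eventually mult_left_mono\<close>)
  then have "(\<lambda>N. (\<Sum>n<N. (b n - b (Suc n)) *\<^sub>R (\<Sum>k\<le>n. a k)) + b N *\<^sub>R (\<Sum>k<N. a k))
      \<longlonglongrightarrow> (\<Sum>n. (b n - b (Suc n)) *\<^sub>R (\<Sum>k\<le>n. a k)) + 0"
    by (intro tendsto_add summable_LIMSEQ summable)
  then show "(\<lambda>n. b n *\<^sub>R a n) sums (\<Sum>n. (b n - b (Suc n)) *\<^sub>R (\<Sum>k\<le>n. a k))"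
    by (simp add: by_parts sums_def)
qed

lemma Toeplitz_null:
  fixes z :: "nat \<Rightarrow> 'a::banach" and w :: "nat \<Rightarrow> 'b \<Rightarrow> real"
  assumes z: "z \<longlonglongrightarrow> 0"
    and w: "\<forall>\<^sub>F s in F. (\<forall>n. 0 \<le> w n s) \<and> summable (\<lambda>n. w n s) \<and> (\<Sum>n. w n s) \<le> V"
    and null: "\<And>n. (w n \<longlongrightarrow> 0) F"
  shows "((\<lambda>s. \<Sum>n. w n s *\<^sub>R z n) \<longlongrightarrow> 0) F"
proof (rule tendstoI)
  fix e :: real assume e: "e > 0"
  define d where "d = e / (2 * (\<bar>V\<bar> + 1))"
  have d: "d > 0" "d * V < e / 2"
    using e by (auto simp: d_def field_simps abs_if)
  obtain N where N: "\<And>n. n \<ge> N \<Longrightarrow> norm (z n) < d"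
    using tendstoD[OF z d(1)] by (auto simp: eventually_sequentially)
  have "((\<lambda>s. \<Sum>n<N. w n s * norm (z n)) \<longlongrightarrow> (\<Sum>n<N. 0 * norm (z n))) F"
    by (intro tendsto_intros null)
  then have "\<forall>\<^sub>F s in F. (\<Sum>n<N. w n s * norm (z n)) < e / 2"
    using e by (intro order_tendstoD) auto
  with w show "\<forall>\<^sub>F s in F. dist (\<Sum>n. w n s *\<^sub>R z n) 0 < e"
  proof eventually_elim
    case (elim s)
    define M where "M = (\<lambda>n. (if n \<in> {..<N} then w n s * norm (z n) else 0) + d * w n s)"
    have M_sums: "M sums ((\<Sum>n<N. w n s * norm (z n)) + d * (\<Sum>n. w n s))"
      unfolding M_def using elim by (intro sums_add sums_If_finite_set sums_mult summable_sums) auto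
    have "norm (w n s *\<^sub>R z n) \<le> M n" for n
    proof (cases "n < N")
      case True
      then show ?thesis
        using elim d(1) by (simp add: M_def)
    next
      case False
      then show ?thesis
        using elim N[of n] by (simp add: M_def mult.commute mult_right_mono)
    qed
    then have "norm (\<Sum>n. w n s *\<^sub>R z n) \<le> (\<Sum>n<N. w n s * norm (z n)) + d * (\<Sum>n. w n s)"
      unfolding sums_unique[OF M_sums] by (intro norm_suminf_le sums_summable[OF M_sums])
    also have "d * (\<Sum>n. w n s) \<le> d * V"
      using elim d(1) by (intro mult_left_mono) auto
    finally show ?case
      using elim d(2) by simp
  qed
qed

lemma Toeplitz_theorem:
  fixes S :: "nat \<Rightarrow> 'a::banach" and w :: "nat \<Rightarrow> 'b \<Rightarrow> real"
  assumes S: "S \<longlonglongrightarrow> A"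
    and w: "\<forall>\<^sub>F s in F. (\<forall>n. 0 \<le> w n s) \<and> (\<lambda>n. w n s) sums W s \<and> summable (\<lambda>n. w n s *\<^sub>R S n)"
    and total: "(W \<longlongrightarrow> l) F" and null: "\<And>n. (w n \<longlongrightarrow> 0) F"
  shows "((\<lambda>s. \<Sum>n. w n s *\<^sub>R S n) \<longlongrightarrow> l *\<^sub>R A) F"
proof -
  have "\<forall>\<^sub>F s in F. (\<forall>n. 0 \<le> w n s) \<and> summable (\<lambda>n. w n s) \<and> (\<Sum>n. w n s) \<le> l + 1"
    using w order_tendstoD(2)[OF total less_add_one] by eventually_elim (auto simp: sums_iff)
  from Toeplitz_null[OF LIM_zero[OF S] this null]
  have "((\<lambda>s. (\<Sum>n. w n s *\<^sub>R (S n - A)) + W s *\<^sub>R A) \<longlongrightarrow> 0 + l *\<^sub>R A) F"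
    by (intro tendsto_intros total)
  moreover have "\<forall>\<^sub>F s in F. (\<Sum>n. w n s *\<^sub>R (S n - A)) + W s *\<^sub>R A = (\<Sum>n. w n s *\<^sub>R S n)"
    using w
  proof eventually_elim
    case (elim s)
    then have "(\<lambda>n. w n s *\<^sub>R S n - w n s *\<^sub>R A) sums ((\<Sum>n. w n s *\<^sub>R S n) - W s *\<^sub>R A)"
      by (intro sums_diff summable_sums sums_scaleR_left) auto
    then show ?case
      by (simp add: sums_iff scaleR_diff_right)
  qed
  ultimately show ?thesis
    by (simp add: Lim_transform_eventually)
qed

definition decreasing_kernel :: "real \<Rightarrow> (real \<Rightarrow> real) \<Rightarrow> bool" where
  "decreasing_kernel l g \<longleftrightarrow>
    antimono_on {0<..} g \<and> (g \<longlongrightarrow> l) (at_right 0) \<and> (g \<longlongrightarrow> 0) at_top"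

lemma decreasing_kernelI:
  assumes "\<And>t. t > 0 \<Longrightarrow> (g has_real_derivative g' t) (at t)" and "\<And>t. t > 0 \<Longrightarrow> g' t \<le> 0"
    and "(g \<longlongrightarrow> l) (at_right 0)" and "(g \<longlongrightarrow> 0) at_top"
  shows "decreasing_kernel l g"
proof -
  have "antimono_on {0<..} g"
  proof (rule monotone_onI)
    fix u v :: real assume "u \<in> {0<..}" "u \<le> v"
    then have "t > 0" if "u \<le> t" for t
      using that by simp
    then show "g v \<le> g u"
      using assms(1,2) by (intro DERIV_nonpos_imp_nonincreasing[OF \<open>u \<le> v\<close>]) blast
  qed
  with assms(3,4) show ?thesis
    by (simp add: decreasing_kernel_def)
qed

text \<open>The case \<open>g t = exp (- t)\<close> is Abel's limit theorem.\<close>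

lemma
  fixes a :: "nat \<Rightarrow> 'a::banach"
  assumes a: "a sums A" and g: "decreasing_kernel l g"
  shows summable_dilated_kernel: "s > 0 \<Longrightarrow> summable (\<lambda>n. g (s * real (Suc n)) *\<^sub>R a n)"
    and tendsto_suminf_dilated_kernel:
      "((\<lambda>s. \<Sum>n. g (s * real (Suc n)) *\<^sub>R a n) \<longlongrightarrow> l *\<^sub>R A) (at_right 0)"
proof -
  have g_antimono: "antimono_on {0<..} g" and g_0: "(g \<longlongrightarrow> l) (at_right 0)"
    and g_top: "(g \<longlongrightarrow> 0) at_top"
    using g by (simp_all add: decreasing_kernel_def)
  define w where "w = (\<lambda>n s. g (s * real (Suc n)) - g (s * real (Suc (Suc n))))"
  obtain B where B: "\<And>n. norm (\<Sum>k<n. a k) \<le> B"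
    using a unfolding sums_def by (metis BseqE Bseq_def convergentI convergent_imp_Bseq)
  have decseq: "decseq (\<lambda>n. g (s * real (Suc n)))" if "s > 0" for s
    using that by (intro decseq_SucI monotone_onD[OF g_antimono]) (auto simp: mult_left_mono)
  have lim: "(\<lambda>n. g (s * real (Suc n))) \<longlonglongrightarrow> 0" if "s > 0" for s
    using that by (intro filterlim_compose[OF g_top]) real_asymp
  have by_parts: "(\<lambda>n. g (s * real (Suc n)) *\<^sub>R a n) sums (\<Sum>n. w n s *\<^sub>R (\<Sum>k\<le>n. a k))"
    if "s > 0" for s
    using sums_Dirichlet_test[OF B decseq lim] that by (simp add: w_def)
  then show "summable (\<lambda>n. g (s * real (Suc n)) *\<^sub>R a n)" if "s > 0" for s
    using that sums_summable by blast
  have "\<forall>\<^sub>F s in at_right 0. (\<forall>n. 0 \<le> w n s) \<and> (\<lambda>n. w n s) sums g s \<and>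
      summable (\<lambda>n. w n s *\<^sub>R (\<Sum>k\<le>n. a k))"
    using eventually_at_right_less[of 0]
  proof eventually_elim
    case (elim s)
    then show ?case
      using decseq_SucD[OF decseq] telescope_sums'[OF lim] summable_Dirichlet_test[OF B decseq lim]
      by (simp add: w_def)
  qed
  moreover have "(\<lambda>n. \<Sum>k\<le>n. a k) \<longlonglongrightarrow> A"
    using a by (simp add: sums_def_le)
  moreover have "(w n \<longlongrightarrow> 0) (at_right 0)" for n
  proof -
    have "((\<lambda>s. g (s * real (Suc m))) \<longlongrightarrow> l) (at_right 0)" for m
      by (intro filterlim_compose[OF g_0]) real_asymp
    from tendsto_diff[OF this[of n] this[of "Suc n"]] show ?thesis
      by (simp add: w_def)
  qed
  ultimately have "((\<lambda>s. \<Sum>n. w n s *\<^sub>R (\<Sum>k\<le>n. a k)) \<longlongrightarrow> l *\<^sub>R A) (at_right 0)"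
    using g_0 by (intro Toeplitz_theorem)
  moreover have "\<forall>\<^sub>F s in at_right 0.
      (\<Sum>n. w n s *\<^sub>R (\<Sum>k\<le>n. a k)) = (\<Sum>n. g (s * real (Suc n)) *\<^sub>R a n)"
    using eventually_at_right_less[of 0] by eventually_elim (rule sums_unique[OF by_parts])
  ultimately show "((\<lambda>s. \<Sum>n. g (s * real (Suc n)) *\<^sub>R a n) \<longlongrightarrow> l *\<^sub>R A) (at_right 0)"
    by (rule Lim_transform_eventually)
qed

section \<open>The logarithmic series on the unit disc\<close>

lemma Ln_one_minus_sums_open_disc:
  assumes "norm z < 1"
  shows "(\<lambda>n. z ^ Suc n / of_nat (Suc n)) sums - Ln (1 - z)"
proof -
  have "(\<lambda>n. - (z ^ n / of_nat n)) sums Ln (1 - z)"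
    using Ln_series'[of "- z"] assms by simp
  from sums_minus[OF this] show ?thesis
    by (subst sums_Suc_iff) simp
qed

lemma one_minus_notin_nonpos_Reals:
  fixes z :: complex
  assumes "norm z \<le> 1" "z \<noteq> 1"
  shows "1 - z \<notin> \<real>\<^sub>\<le>\<^sub>0"
proof
  assume "1 - z \<in> \<real>\<^sub>\<le>\<^sub>0"
  then have "Re z \<ge> 1" "Im z = 0"
    by (auto simp: complex_nonpos_Reals_iff)
  moreover from this have "Re z \<le> 1"
    using complex_Re_le_cmod[of z] assms(1) by linarith
  ultimately show False
    using assms(2) by (simp add: complex_eq_iff)
qed

lemma norm_mult_exp_uminus_less_1:
  assumes "norm c \<le> 1" "Re v > 0"
  shows "norm (c * exp (- v)) < 1"
proof -
  have "norm (c * exp (- v)) \<le> 1 * exp (- Re v)"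
    unfolding norm_mult using assms(1) by (intro mult_mono) (auto simp: norm_exp_eq_Re)
  also have "\<dots> < 1"
    using assms(2) by simp
  finally show ?thesis .
qed

lemma summable_power_div_Suc:
  fixes c :: complex
  assumes c: "norm c \<le> 1" "c \<noteq> 1"
  shows "summable (\<lambda>n. c ^ Suc n / of_nat (Suc n))"
proof -
  have "norm (\<Sum>k<n. c ^ Suc k) \<le> 2 / norm (1 - c)" for n
  proof -
    have "(\<Sum>k<n. c ^ Suc k) = c * (1 - c ^ n) / (1 - c)"
      using c(2) by (simp add: sum_gp_strict flip: sum_distrib_left)
    also have "norm \<dots> \<le> 1 * (1 + 1) / norm (1 - c)"
      unfolding norm_divide norm_mult using c
      by (intro divide_right_mono mult_mono order_trans[OF norm_triangle_ineq4] add_mono)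
         (auto simp: norm_power power_le_one)
    finally show ?thesis
      by simp
  qed
  moreover have "decseq (\<lambda>n. 1 / real (Suc n))"
    by (intro decseq_SucI) (simp add: frac_le)
  moreover have "(\<lambda>n. 1 / real (Suc n)) \<longlonglongrightarrow> 0"
    by real_asymp
  ultimately have "summable (\<lambda>n. (1 / real (Suc n)) *\<^sub>R c ^ Suc n)"
    by (rule sums_summable[OF sums_Dirichlet_test])
  then show ?thesis
    by (simp add: scaleR_conv_of_real)
qed

lemma Ln_one_minus_sums:
  assumes c: "norm c \<le> 1" "c \<noteq> 1"
  shows "(\<lambda>n. c ^ Suc n / of_nat (Suc n)) sums - Ln (1 - c)"
proof -
  define a where "a = (\<lambda>n. c ^ Suc n / of_nat (Suc n))"
  have a: "a sums (\<Sum>n. a n)"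
    unfolding a_def by (intro summable_sums summable_power_div_Suc c)
  have "decreasing_kernel 1 (\<lambda>t. exp (- t))"
    by (rule decreasing_kernelI[where g' = "\<lambda>t. - exp (- t)"])
       ((auto intro!: derivative_eq_intros)[2], real_asymp+)
  from tendsto_suminf_dilated_kernel[OF a this]
  have "((\<lambda>s. \<Sum>n. exp (- (s * real (Suc n))) *\<^sub>R a n) \<longlongrightarrow> (\<Sum>n. a n)) (at_right 0)"
    by simp
  moreover have "\<forall>\<^sub>F s in at_right 0.
      (\<Sum>n. exp (- (s * real (Suc n))) *\<^sub>R a n) = - Ln (1 - c * exp (- of_real s))"
    using eventually_at_right_less[of 0]
  proof eventually_elim
    case (elim s)
    have "exp (- complex_of_real s) ^ Suc n = of_real (exp (- (s * real (Suc n))))" for n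
      by (simp add: mult.commute flip: exp_of_nat_mult exp_of_real del: power_Suc of_nat_Suc)
    then have "(c * exp (- of_real s)) ^ Suc n / of_nat (Suc n) =
        exp (- (s * real (Suc n))) *\<^sub>R a n" for n
      by (simp add: a_def scaleR_conv_of_real power_mult_distrib mult.commute
          del: power_Suc of_nat_Suc)
    with Ln_one_minus_sums_open_disc[OF norm_mult_exp_uminus_less_1[OF c(1), of "of_real s"]] elim
    show ?case
      by (simp add: sums_iff del: power_Suc of_nat_Suc)
  qed
  ultimately have "((\<lambda>s. - Ln (1 - c * exp (- of_real s))) \<longlongrightarrow> (\<Sum>n. a n)) (at_right 0)"
    by (rule Lim_transform_eventually)
  moreover have "((\<lambda>s::real. - Ln (1 - c * exp (- of_real s))) \<longlongrightarrow>
      - Ln (1 - c * exp (- of_real 0))) (at_right 0)"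
    using one_minus_notin_nonpos_Reals[OF c] by (intro tendsto_intros) auto
  ultimately have "(\<Sum>n. a n) = - Ln (1 - c)"
    using tendsto_unique[OF trivial_limit_at_right_real] by fastforce
  with a show ?thesis
    by (simp add: a_def)
qed

section \<open>Logarithms of \<open>q\<close>-Pochhammer symbols as Lambert series\<close>

text \<open>For \<open>Re t > 0\<close> this is the geometric series \<open>\<Sum>k. exp (-(x + k) t)\<close>.\<close>

definition exp_geometric :: "real \<Rightarrow> complex \<Rightarrow> complex" where
  "exp_geometric x t = exp (- (of_real x * t)) / (1 - exp (- t))"

lemma exp_uminus_neq_1:
  assumes "Re t > 0"
  shows "exp (- t) \<noteq> (1 :: complex)"
  using assms by (simp add: exp_eq_1)

lemma norm_exp_geometric_le:
  assumes h: "h > 0" and t: "Re t \<ge> h"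
  shows "norm (exp_geometric x t) \<le> exp (- (x * Re t)) / (1 - exp (- h))"
proof -
  have "1 - exp (- h) \<le> 1 - norm (exp (- t))"
    using t by (simp add: norm_exp_eq_Re)
  also have "\<dots> \<le> norm (1 - exp (- t))"
    using norm_triangle_ineq2[of 1 "exp (- t)"] by simp
  finally show ?thesis
    using h by (simp add: exp_geometric_def norm_divide norm_exp_eq_Re frac_le)
qed

lemma exp_geometric_diff:
  assumes "Re t > 0"
  shows "exp_geometric x t - exp_geometric (x + 1) t = exp (- (of_real x * t))"
proof -
  have "exp (- (of_real (x + 1) * t)) = exp (- (of_real x * t)) * exp (- t)"
    by (simp add: algebra_simps flip: exp_add)
  then have "exp_geometric x t - exp_geometric (x + 1) t =
      exp (- (of_real x * t)) * (1 - exp (- t)) / (1 - exp (- t))"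
    by (simp add: exp_geometric_def right_diff_distrib flip: diff_divide_distrib)
  then show ?thesis
    using exp_uminus_neq_1[OF assms] by simp
qed

lemma exp_geometric_multisection:
  assumes m: "m > 0" and t: "Re t > 0"
  shows "exp_geometric x t = (\<Sum>l<m. exp_geometric ((x + real l) / real m) (of_nat m * t))"
proof -
  define q where "q = exp (- t)"
  have q: "q \<noteq> 1" "q ^ m = exp (- (of_nat m * t))" "q ^ m \<noteq> 1"
    using exp_uminus_neq_1[of t] exp_uminus_neq_1[of "of_nat m * t"] m t
    by (simp_all add: q_def flip: exp_of_nat_mult)
  have summand: "exp_geometric ((x + real l) / real m) (of_nat m * t) =
      exp (- (of_real x * t)) / (1 - q ^ m) * q ^ l" for l
  proof -
    have "of_real ((x + real l) / real m) * (of_nat m * t) = of_real x * t + of_nat l * t"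
      using m by (simp add: field_simps)
    then have "exp (- (of_real ((x + real l) / real m) * (of_nat m * t))) =
        exp (- (of_real x * t)) * q ^ l"
      by (simp only: minus_add_distrib exp_add) (simp add: q_def flip: exp_of_nat_mult)
    then show ?thesis
      by (simp only: exp_geometric_def q(2)) simp
  qed
  have "(\<Sum>l<m. exp_geometric ((x + real l) / real m) (of_nat m * t)) =
      exp (- (of_real x * t)) / (1 - q ^ m) * ((1 - q ^ m) / (1 - q))"
    unfolding summand sum_distrib_left[symmetric] using q(1) by (simp add: sum_gp_strict)
  also have "\<dots> = exp_geometric x t"
    using q by (simp add: exp_geometric_def q_def)
  finally show ?thesis ..
qed

lemma exp_geometric_add_ii:
  assumes "cis \<phi> = 1"
  shows "exp_geometric x (t + \<i> * of_real \<phi>) = cis (- (x * \<phi>)) * exp_geometric x t"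
proof -
  have "exp (- (t + \<i> * of_real \<phi>)) = exp (- t)"
    using assms by (simp add: exp_diff flip: cis_conv_exp)
  moreover have "exp (- (of_real x * (t + \<i> * of_real \<phi>))) =
      cis (- (x * \<phi>)) * exp (- (of_real x * t))"
    by (simp add: cis_conv_exp algebra_simps flip: exp_add)
  ultimately show ?thesis
    by (simp add: exp_geometric_def)
qed

definition lambert_term :: "complex \<Rightarrow> real \<Rightarrow> complex \<Rightarrow> nat \<Rightarrow> complex" where
  "lambert_term c x w n = c ^ Suc n / of_nat (Suc n) * exp_geometric x (of_nat (Suc n) * w)"

text \<open>The logarithm of \<open>\<Prod>k. 1 - c q\<^sup>x\<^sup>+\<^sup>k\<close> with \<open>q = exp (-w)\<close>.\<close>

definition ln_qpoch :: "complex \<Rightarrow> real \<Rightarrow> complex \<Rightarrow> complex" where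
  "ln_qpoch c x w = - (\<Sum>n. lambert_term c x w n)"

lemma norm_lambert_term_le:
  assumes c: "norm c \<le> 1" and x: "x > 0" and h: "h > 0" and w: "Re w \<ge> h"
  shows "norm (lambert_term c x w n) \<le> exp (- (x * Re w)) / (1 - exp (- h)) * exp (- (x * h)) ^ n"
proof -
  have Re_ge: "Re w + real n * h \<le> Re (of_nat (Suc n) * w)"
    using mult_left_mono[OF w, of "real n"] by (simp add: algebra_simps)
  then have "h \<le> Re (of_nat (Suc n) * w)"
    using w h by (smt (verit) mult_nonneg_nonneg of_nat_0_le_iff)
  from norm_exp_geometric_le[OF h this]
  have "norm (exp_geometric x (of_nat (Suc n) * w)) \<le>
      exp (- (x * Re (of_nat (Suc n) * w))) / (1 - exp (- h))" .
  also have "\<dots> \<le> exp (- (x * (Re w + real n * h))) / (1 - exp (- h))"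
    using Re_ge x h by (intro divide_right_mono) auto
  also have "\<dots> = exp (- (x * Re w)) / (1 - exp (- h)) * exp (- (x * h)) ^ n"
    by (simp add: algebra_simps flip: exp_add exp_of_nat_mult)
  finally have kernel: "norm (exp_geometric x (of_nat (Suc n) * w)) \<le>
      exp (- (x * Re w)) / (1 - exp (- h)) * exp (- (x * h)) ^ n" .
  have "norm (c ^ Suc n / of_nat (Suc n)) \<le> 1 / 1"
    unfolding norm_divide norm_power norm_of_nat by (intro frac_le power_le_one c) auto
  from mult_mono[OF this kernel] show ?thesis
    unfolding lambert_term_def norm_mult by simp
qed

lemma summable_mult_exp_uminus_power:
  fixes x h K :: real
  assumes "x > 0" "h > 0"
  shows "summable (\<lambda>n. K * exp (- (x * h)) ^ n)"
  using assms by (intro summable_mult summable_geometric) auto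

lemma summable_lambert_term:
  assumes "norm c \<le> 1" "x > 0" "Re w > 0"
  shows "summable (lambert_term c x w)"
proof (rule summable_comparison_test')
  show "summable (\<lambda>n. exp (- (x * Re w)) / (1 - exp (- Re w)) * exp (- (x * Re w)) ^ n)"
    using assms by (intro summable_mult_exp_uminus_power)
qed (use assms in \<open>intro norm_lambert_term_le; simp\<close>)

lemma lambert_term_sums:
  assumes "norm c \<le> 1" "x > 0" "Re w > 0"
  shows "lambert_term c x w sums - ln_qpoch c x w"
  unfolding ln_qpoch_def minus_minus by (intro summable_sums summable_lambert_term assms)

lemma norm_ln_qpoch_le:
  assumes "norm c \<le> 1" "x > 0" "h > 0" "Re w \<ge> h"
  shows "norm (ln_qpoch c x w) \<le> exp (- (x * Re w)) / ((1 - exp (- h)) * (1 - exp (- (x * h))))"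
proof -
  have "norm (ln_qpoch c x w) \<le> (\<Sum>n. exp (- (x * Re w)) / (1 - exp (- h)) * exp (- (x * h)) ^ n)"
    unfolding ln_qpoch_def norm_minus_cancel
    by (intro norm_suminf_le norm_lambert_term_le summable_mult_exp_uminus_power assms)
  also have "\<dots> = exp (- (x * Re w)) / (1 - exp (- h)) * (1 / (1 - exp (- (x * h))))"
    using assms by (intro sums_unique[symmetric] sums_mult geometric_sums) auto
  finally show ?thesis
    by simp
qed

lemma holomorphic_lambert_term: "(\<lambda>w. lambert_term c x w n) holomorphic_on {w. Re w > 0}"
proof -
  have "1 - exp (- (of_nat (Suc n) * w)) \<noteq> 0" if "w \<in> {w. Re w > 0}" for w
    using exp_uminus_neq_1[of "of_nat (Suc n) * w"] that by (simp add: zero_less_mult_iff)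
  then show ?thesis
    unfolding lambert_term_def exp_geometric_def by (intro holomorphic_intros) auto
qed

lemma holomorphic_ln_qpoch:
  assumes c: "norm c \<le> 1" and x: "x > 0"
  shows "ln_qpoch c x holomorphic_on {w. Re w > 0}"
proof -
  have "(\<lambda>w. \<Sum>n. lambert_term c x w n) holomorphic_on {w. Re w > 0}"
  proof (rule holomorphic_uniform_sequence[OF open_halfspace_Re_gt])
    show "(\<lambda>w. \<Sum>n<N. lambert_term c x w n) holomorphic_on {w. Re w > 0}" for N
      by (intro holomorphic_intros holomorphic_lambert_term)
    fix w :: complex assume w: "w \<in> {w. Re w > 0}"
    define h where "h = Re w / 2"
    have h: "h > 0"
      using w by (simp add: h_def)
    have Re_ge: "Re v \<ge> h" if "v \<in> cball w h" for v
      using that abs_Re_le_cmod[of "w - v"] by (simp add: dist_norm h_def)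
    have "uniform_limit (cball w h) (\<lambda>N v. \<Sum>n<N. lambert_term c x v n)
        (\<lambda>v. \<Sum>n. lambert_term c x v n) sequentially"
    proof (rule Weierstrass_m_test)
      fix n v assume v: "v \<in> cball w h"
      have "norm (lambert_term c x v n) \<le>
          exp (- (x * Re v)) / (1 - exp (- h)) * exp (- (x * h)) ^ n"
        using c x h Re_ge[OF v] by (intro norm_lambert_term_le) auto
      also have "\<dots> \<le> 1 / (1 - exp (- h)) * exp (- (x * h)) ^ n"
        using x h Re_ge[OF v] by (intro mult_right_mono divide_right_mono) auto
      finally show "norm (lambert_term c x v n) \<le> 1 / (1 - exp (- h)) * exp (- (x * h)) ^ n" .
    qed (use x h in \<open>intro summable_mult_exp_uminus_power\<close>)
    moreover have "cball w h \<subseteq> {w. Re w > 0}"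
      using Re_ge h by force
    ultimately show "\<exists>h>0. cball w h \<subseteq> {w. Re w > 0} \<and> uniform_limit (cball w h)
        (\<lambda>N v. \<Sum>n<N. lambert_term c x v n) (\<lambda>v. \<Sum>n. lambert_term c x v n) sequentially"
      using h by blast
  qed
  then show ?thesis
    unfolding ln_qpoch_def[abs_def] by (rule holomorphic_on_minus)
qed

lemma ln_qpoch_shift:
  assumes c: "norm c \<le> 1" and x: "x > 0" and w: "Re w > 0"
  shows "ln_qpoch c x w = Ln (1 - c * exp (- (of_real x * w))) + ln_qpoch c (x + 1) w"
proof -
  define z where "z = c * exp (- (of_real x * w))"
  have z: "norm z < 1"
    unfolding z_def using c x w by (intro norm_mult_exp_uminus_less_1) auto
  have "lambert_term c x w n - lambert_term c (x + 1) w n = z ^ Suc n / of_nat (Suc n)" for n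
  proof -
    have "Re (of_nat (Suc n) * w) > 0"
      using w by (simp add: zero_less_mult_iff)
    then have diff: "exp_geometric x (of_nat (Suc n) * w) -
        exp_geometric (x + 1) (of_nat (Suc n) * w) = exp (- (of_real x * w)) ^ Suc n"
      by (simp add: exp_geometric_diff mult_ac flip: exp_of_nat_mult del: of_nat_Suc power_Suc)
    show ?thesis
      unfolding lambert_term_def right_diff_distrib[symmetric] diff z_def power_mult_distrib by simp
  qed
  moreover have "(\<lambda>n. lambert_term c x w n - lambert_term c (x + 1) w n) sums
      (- ln_qpoch c x w - - ln_qpoch c (x + 1) w)"
    using c x w by (intro sums_diff lambert_term_sums) auto
  ultimately have "- ln_qpoch c x w - - ln_qpoch c (x + 1) w = - Ln (1 - z)"
    using sums_unique2[OF _ Ln_one_minus_sums_open_disc[OF z]] by simp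
  then show ?thesis
    by (simp add: z_def algebra_simps)
qed

lemma sums_Ln_ln_qpoch:
  assumes c: "norm c \<le> 1" and x: "x > 0" and w: "Re w > 0"
  shows "(\<lambda>k. Ln (1 - c * exp (- (of_real (x + real k) * w)))) sums ln_qpoch c x w"
proof -
  have "(\<lambda>k. ln_qpoch c (x + real k) w) \<longlonglongrightarrow> 0"
  proof (rule Lim_null_comparison)
    show "\<forall>\<^sub>F k in sequentially. norm (ln_qpoch c (x + real k) w) \<le>
        exp (- ((x + real k) * Re w)) / ((1 - exp (- Re w)) * (1 - exp (- ((x + real k) * Re w))))"
      using c x w by (intro always_eventually allI norm_ln_qpoch_le) auto
    show "(\<lambda>k. exp (- ((x + real k) * Re w)) /
        ((1 - exp (- Re w)) * (1 - exp (- ((x + real k) * Re w))))) \<longlonglongrightarrow> 0"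
      using w by real_asymp
  qed
  then have "(\<lambda>k. ln_qpoch c (x + real k) w - ln_qpoch c (x + real (Suc k)) w)
      sums (ln_qpoch c (x + real 0) w - 0)"
    by (rule telescope_sums')
  moreover have "ln_qpoch c (x + real k) w - ln_qpoch c (x + real (Suc k)) w =
      Ln (1 - c * exp (- (of_real (x + real k) * w)))" for k
    using ln_qpoch_shift[OF c _ w, of "x + real k"] x by (simp add: add_ac)
  ultimately show ?thesis
    by simp
qed

lemma exp_ln_qpoch:
  assumes c: "norm c \<le> 1" and x: "x > 0" and w: "Re w > 0"
  shows "exp (ln_qpoch c x w) = (\<Prod>k. 1 - c * exp (- (of_real (x + real k) * w)))"
proof -
  have "exp (Ln (1 - c * exp (- (of_real (x + real k) * w)))) =
      1 - c * exp (- (of_real (x + real k) * w))" for k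
  proof -
    have "norm (c * exp (- (of_real (x + real k) * w))) < 1"
      using c x w by (intro norm_mult_exp_uminus_less_1) (auto intro: mult_pos_pos)
    then show ?thesis
      by (intro exp_Ln) auto
  qed
  with prodinf_exp[OF sums_summable[OF sums_Ln_ln_qpoch[OF assms]]] show ?thesis
    by (simp add: sums_unique[OF sums_Ln_ln_qpoch[OF assms]])
qed

lemma ln_qpoch_multisection:
  assumes m: "m > 0" and c: "norm c \<le> 1" and x: "x > 0" and w: "Re w > 0"
  shows "ln_qpoch c x w = (\<Sum>l<m. ln_qpoch c ((x + real l) / real m) (of_nat m * w))"
proof -
  have "lambert_term c x w n =
      (\<Sum>l<m. lambert_term c ((x + real l) / real m) (of_nat m * w) n)" for n
    using exp_geometric_multisection[of m "of_nat (Suc n) * w" x] m w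
    by (simp add: lambert_term_def zero_less_mult_iff sum_distrib_left
        mult.left_commute[of "of_nat m"] del: of_nat_Suc power_Suc)
  then have terms: "lambert_term c x w =
      (\<lambda>n. \<Sum>l<m. lambert_term c ((x + real l) / real m) (of_nat m * w) n)" ..
  have "lambert_term c x w sums (\<Sum>l<m. - ln_qpoch c ((x + real l) / real m) (of_nat m * w))"
    unfolding terms using m c x w
    by (intro sums_sum lambert_term_sums) (auto simp: add_pos_nonneg)
  from sums_unique2[OF lambert_term_sums[OF c x w] this] show ?thesis
    by (simp add: sum_negf)
qed

lemma ln_qpoch_add_ii:
  assumes "cis \<phi> = 1"
  shows "ln_qpoch c x (w + \<i> * of_real \<phi>) = ln_qpoch (c * cis (- (x * \<phi>))) x w"
proof -
  have "lambert_term c x (w + \<i> * of_real \<phi>) n = lambert_term (c * cis (- (x * \<phi>))) x w n" for n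
  proof -
    have "cis (real (Suc n) * \<phi>) = 1"
      using Complex.DeMoivre[of \<phi> "Suc n"] assms by (simp del: power_Suc of_nat_Suc)
    from exp_geometric_add_ii[OF this, of x "of_nat (Suc n) * w"]
    have "exp_geometric x (of_nat (Suc n) * (w + \<i> * of_real \<phi>)) =
        cis (- (x * \<phi>)) ^ Suc n * exp_geometric x (of_nat (Suc n) * w)"
      by (simp add: Complex.DeMoivre algebra_simps del: power_Suc)
    then show ?thesis
      by (simp add: lambert_term_def power_mult_distrib mult_ac del: power_Suc of_nat_Suc)
  qed
  then show ?thesis
    by (simp add: ln_qpoch_def)
qed

section \<open>Expansion at a point of the unit circle other than 1\<close>

definition dilog :: "complex \<Rightarrow> complex" where
  "dilog c = (\<Sum>n. c ^ Suc n / of_nat (Suc n) ^ 2)"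

lemma summable_inverse_Suc_squares: "summable (\<lambda>n. 1 / real (Suc n) ^ 2)"
  using inverse_squares_sums by (simp add: sums_iff add_ac)

lemma norm_dilog_term_le:
  fixes c :: complex
  assumes "norm c \<le> 1"
  shows "norm (c ^ Suc n / of_nat (Suc n) ^ 2) \<le> 1 / real (Suc n) ^ 2"
  unfolding norm_divide norm_power norm_of_nat using assms
  by (intro divide_right_mono power_le_one) auto

lemma dilog_sums:
  assumes "norm c \<le> 1"
  shows "(\<lambda>n. c ^ Suc n / of_nat (Suc n) ^ 2) sums dilog c"
  unfolding dilog_def
  by (intro summable_sums assms
      summable_comparison_test'[OF summable_inverse_Suc_squares norm_dilog_term_le])

lemma exp_geometric_of_real:
  "exp_geometric x (of_real t) = of_real (exp (- (x * t)) / (1 - exp (- t)))"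
  by (simp add: exp_geometric_def flip: exp_of_real)

lemma le_sinh_real:
  fixes t :: real
  assumes "t \<ge> 0"
  shows "t \<le> sinh t"
proof -
  have "sinh 0 - 0 \<le> sinh t - t"
  proof (rule DERIV_nonneg_imp_nondecreasing[OF assms])
    fix u :: real
    have "((\<lambda>u. sinh u - u) has_real_derivative cosh u - 1) (at u)"
      by (auto intro!: derivative_eq_intros)
    then show "\<exists>d. ((\<lambda>u. sinh u - u) has_real_derivative d) (at u) \<and> 0 \<le> d"
      using cosh_real_ge_1[of u] by (intro exI[of _ "cosh u - 1"]) simp
  qed
  then show ?thesis
    by simp
qed

lemma decreasing_kernel_inverse_minus_inverse_expm1:
  "decreasing_kernel (1/2) (\<lambda>t. 1 / t - 1 / (exp t - 1))"
proof (rule decreasing_kernelI)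
  fix t :: real assume t: "t > 0"
  then show "((\<lambda>t. 1 / t - 1 / (exp t - 1)) has_real_derivative
      - 1 / t\<^sup>2 + exp t / (exp t - 1)\<^sup>2) (at t)"
    by (auto intro!: derivative_eq_intros simp: power2_eq_square)
  have half: "exp (t / 2) * exp (t / 2) = exp t"
    by (simp flip: exp_add)
  have "2 * sinh (t / 2) = exp (t / 2) - exp (- (t / 2))"
    by (simp add: sinh_field_def)
  then have "exp (t / 2) * t \<le> exp (t / 2) * (exp (t / 2) - exp (- (t / 2)))"
    using le_sinh_real[of "t / 2"] t by simp
  also have "\<dots> = exp t - 1"
    by (simp add: right_diff_distrib half exp_minus_inverse)
  finally have "(exp (t / 2) * t)\<^sup>2 \<le> (exp t - 1)\<^sup>2"
    using t by (intro power_mono) auto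
  then have "exp t * t\<^sup>2 \<le> (exp t - 1)\<^sup>2"
    by (simp add: power_mult_distrib power2_eq_square[of "exp _"] half)
  then show "- 1 / t\<^sup>2 + exp t / (exp t - 1)\<^sup>2 \<le> 0"
    using t by (simp add: field_simps)
qed real_asymp+

lemma decreasing_kernel_exp_geometric_minus:
  assumes x: "0 < x" "x \<le> 1"
  shows "decreasing_kernel (1 - x) (\<lambda>t. exp (- (x * t)) / (1 - exp (- t)) - 1 / (exp t - 1))"
    (is "decreasing_kernel _ ?r")
proof (rule decreasing_kernelI)
  define y where "y = 1 - x"
  have r: "?r = (\<lambda>t. (exp (y * t) - 1) / (exp t - 1))"
  proof
    fix t
    have "exp (y * t) = exp t * exp (- (x * t))" "exp t - 1 = exp t * (1 - exp (- t))"
      by (simp_all add: y_def algebra_simps flip: exp_add)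
    then have "exp (y * t) / (exp t - 1) = exp (- (x * t)) / (1 - exp (- t))"
      by simp
    then show "?r t = (exp (y * t) - 1) / (exp t - 1)"
      by (simp add: diff_divide_distrib)
  qed
  fix t :: real assume t: "t > 0"
  then show "(?r has_real_derivative
      (y * exp (y * t) * (exp t - 1) - (exp (y * t) - 1) * exp t) / (exp t - 1)\<^sup>2) (at t)"
    unfolding r by (auto intro!: derivative_eq_intros simp: power2_eq_square)
  have "exp (x * t) \<le> y + x * exp t"
    using convex_onD[OF exp_convex, of x 0 t] x by (simp add: y_def)
  then have "exp (y * t) * exp (x * t) \<le> exp (y * t) * (y + x * exp t)"
    by simp
  then have "exp t \<le> exp (y * t) * (y + x * exp t)"
    by (simp add: y_def algebra_simps flip: exp_add)
  then show "(y * exp (y * t) * (exp t - 1) - (exp (y * t) - 1) * exp t) / (exp t - 1)\<^sup>2 \<le> 0"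
    by (intro divide_nonpos_nonneg) (simp_all add: y_def algebra_simps)
next
  show "(?r \<longlongrightarrow> 1 - x) (at_right 0)"
    by real_asymp
  have "((\<lambda>t. exp (- (x * t)) / (1 - exp (- t))) \<longlongrightarrow> 0) at_top"
    "((\<lambda>t::real. 1 / (exp t - 1)) \<longlongrightarrow> 0) at_top"
    using x by real_asymp+
  from tendsto_diff[OF this] show "(?r \<longlongrightarrow> 0) at_top"
    by simp
qed

definition ln_qpoch_reg :: "complex \<Rightarrow> real \<Rightarrow> real \<Rightarrow> complex" where
  "ln_qpoch_reg c x s = ln_qpoch c x (of_real s) + dilog c / of_real s"

lemma ln_qpoch_reg_sums:
  assumes c: "norm c \<le> 1" and x: "x > 0" and s: "s > 0"
  defines "t \<equiv> \<lambda>n. s * real (Suc n)"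
  shows "(\<lambda>n. (exp (- (x * t n)) / (1 - exp (- t n)) - 1 / t n) *\<^sub>R (c ^ Suc n / of_nat (Suc n)))
    sums - ln_qpoch_reg c x s"
proof -
  have summand: "lambert_term c x (of_real s) n + c ^ Suc n / of_nat (Suc n) ^ 2 / of_real (- s) =
      (exp (- (x * t n)) / (1 - exp (- t n)) - 1 / t n) *\<^sub>R (c ^ Suc n / of_nat (Suc n))" for n
  proof -
    have "of_nat (Suc n) * complex_of_real s = of_real (t n)"
      by (simp add: t_def)
    then have kernel: "exp_geometric x (of_nat (Suc n) * of_real s) =
        of_real (exp (- (x * t n)) / (1 - exp (- t n)))"
      by (simp only: exp_geometric_of_real)
    show ?thesis
      unfolding lambert_term_def kernel scaleR_diff_left
      by (simp add: t_def scaleR_conv_of_real power2_eq_square mult_ac del: of_nat_Suc power_Suc)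
  qed
  have "(\<lambda>n. lambert_term c x (of_real s) n + c ^ Suc n / of_nat (Suc n) ^ 2 / of_real (- s))
      sums (- ln_qpoch c x (of_real s) + dilog c / of_real (- s))"
    using c x s by (intro sums_add sums_divide lambert_term_sums dilog_sums) auto
  then show ?thesis
    unfolding summand by (simp add: ln_qpoch_reg_def)
qed

lemma tendsto_ln_qpoch_reg:
  assumes c: "norm c \<le> 1" "c \<noteq> 1" and x: "0 < x" "x \<le> 1"
  shows "(ln_qpoch_reg c x \<longlongrightarrow> of_real (1/2 - x) * Ln (1 - c)) (at_right 0)"
proof -
  define a where "a = (\<lambda>n. c ^ Suc n / of_nat (Suc n))"
  define g where "g = (\<lambda>t::real. 1 / t - 1 / (exp t - 1))"
  define r where "r = (\<lambda>t::real. exp (- (x * t)) / (1 - exp (- t)) - 1 / (exp t - 1))"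
  have a: "a sums - Ln (1 - c)"
    unfolding a_def by (rule Ln_one_minus_sums[OF c])
  have g: "decreasing_kernel (1/2) g"
    unfolding g_def by (rule decreasing_kernel_inverse_minus_inverse_expm1)
  have r: "decreasing_kernel (1 - x) r"
    unfolding r_def using x by (rule decreasing_kernel_exp_geometric_minus)
  have "((\<lambda>s. (\<Sum>n. g (s * real (Suc n)) *\<^sub>R a n) - (\<Sum>n. r (s * real (Suc n)) *\<^sub>R a n)) \<longlongrightarrow>
      (1/2) *\<^sub>R (- Ln (1 - c)) - (1 - x) *\<^sub>R (- Ln (1 - c))) (at_right 0)"
    by (intro tendsto_diff tendsto_suminf_dilated_kernel a g r)
  also have "(1/2) *\<^sub>R (- Ln (1 - c)) - (1 - x) *\<^sub>R (- Ln (1 - c)) = of_real (1/2 - x) * Ln (1 - c)"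
    by (simp add: scaleR_conv_of_real algebra_simps)
  finally show ?thesis
  proof (rule Lim_transform_eventually)
    show "\<forall>\<^sub>F s in at_right 0.
        (\<Sum>n. g (s * real (Suc n)) *\<^sub>R a n) - (\<Sum>n. r (s * real (Suc n)) *\<^sub>R a n) = ln_qpoch_reg c x s"
      using eventually_at_right_less[of 0]
    proof eventually_elim
      case (elim s)
      have "(\<lambda>n. r (s * real (Suc n)) *\<^sub>R a n - g (s * real (Suc n)) *\<^sub>R a n)
          sums - ln_qpoch_reg c x s"
        using ln_qpoch_reg_sums[OF c(1) x(1) elim]
        by (simp add: r_def g_def a_def del: of_nat_Suc flip: scaleR_diff_left)
      then have "(\<Sum>n. r (s * real (Suc n)) *\<^sub>R a n) - (\<Sum>n. g (s * real (Suc n)) *\<^sub>R a n) =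
          - ln_qpoch_reg c x s"
        using summable_dilated_kernel[OF a r elim] summable_dilated_kernel[OF a g elim]
        by (simp only: sums_iff suminf_diff)
      then show ?case
        by algebra
    qed
  qed
qed

section \<open>Expansion at 1\<close>

lemma tendsto_suminf_dominated:
  fixes f :: "nat \<Rightarrow> 'b \<Rightarrow> 'a::{real_normed_algebra,banach}"
  assumes "\<And>k. (f k \<longlongrightarrow> g k) F" and "\<forall>\<^sub>F s in F. \<forall>k. norm (f k s) \<le> M k" and "summable M"
    and "F \<noteq> bot"
  shows "((\<lambda>s. \<Sum>k. f k s) \<longlongrightarrow> (\<Sum>k. g k)) F"
proof -
  have "\<forall>\<^sub>F (k, s) in at_top \<times>\<^sub>F F. norm (f k s) \<le> M k"
    using eventually_prodI[OF eventually_True assms(2), of at_top] by (auto elim: eventually_mono)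
  from tannerys_theorem[OF assms(1) this assms(3,4)] show ?thesis
    by blast
qed

lemma exp_geometric_times_le:
  fixes x t :: real
  assumes "x > 0" "t > 0"
  shows "t * (exp (- (x * t)) / (1 - exp (- t))) \<le> 1 + 1 / x"
proof -
  have exp_le: "exp (- u) \<le> 1 / (1 + u)" if "u > 0" for u :: real
    using exp_ge_add_one_self[of u] that by (simp add: exp_minus field_simps)
  have "t / (1 + t) \<le> 1 - exp (- t)"
    using exp_le[OF assms(2)] assms by (simp add: field_simps)
  then have "t * (exp (- (x * t)) / (1 - exp (- t))) \<le> t * ((1 / (1 + x * t)) / (t / (1 + t)))"
    using assms exp_le[of "x * t"] by (intro mult_left_mono frac_le) auto
  also have "\<dots> = (1 + t) / (1 + x * t)"
    using assms by simp
  also have "\<dots> \<le> 1 + 1 / x"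
    using assms by (simp add: field_simps add_pos_pos)
  finally show ?thesis .
qed

lemma ln_qpoch_leading_term:
  assumes c: "norm c \<le> 1" and x: "x > 0"
  shows "((\<lambda>s. of_real s * ln_qpoch c x (of_real s)) \<longlongrightarrow> - dilog c) (at_right 0)"
proof -
  define h where "h = (\<lambda>t. t * (exp (- (x * t)) / (1 - exp (- t))))"
  define f where "f = (\<lambda>n s. c ^ Suc n / of_nat (Suc n) ^ 2 * of_real (h (s * real (Suc n))))"
  have h_bound: "norm (h t) \<le> 1 + 1 / x" if "t > 0" for t
    using exp_geometric_times_le[OF x that] that by (simp add: h_def)
  have h_lim: "(h \<longlongrightarrow> 1) (at_right 0)"
    unfolding h_def by real_asymp
  have f_lim: "(f n \<longlongrightarrow> c ^ Suc n / of_nat (Suc n) ^ 2 * of_real 1) (at_right 0)" for n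
    unfolding f_def by (intro tendsto_intros filterlim_compose[OF h_lim]) real_asymp
  have "norm (f n s) \<le> (1 + 1 / x) * (1 / real (Suc n) ^ 2)" if "s > 0" for n s
    unfolding f_def norm_mult mult.commute[of "1 + 1 / x"] norm_of_real
    using that c x h_bound[of "s * real (Suc n)"] by (intro mult_mono norm_dilog_term_le) auto
  then have f_bound: "\<forall>\<^sub>F s in at_right 0. \<forall>n. norm (f n s) \<le> (1 + 1 / x) * (1 / real (Suc n) ^ 2)"
    using eventually_at_right_less[of "0::real"] by (auto elim: eventually_mono)
  have "((\<lambda>s. \<Sum>n. f n s) \<longlongrightarrow> dilog c) (at_right 0)"
    using tendsto_suminf_dominated[OF f_lim f_bound summable_mult[OF summable_inverse_Suc_squares]]
    by (simp add: dilog_def)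
  moreover have "\<forall>\<^sub>F s in at_right 0. (\<Sum>n. f n s) = - (of_real s * ln_qpoch c x (of_real s))"
    using eventually_at_right_less[of 0]
  proof eventually_elim
    case (elim s)
    have "f n s = of_real s * lambert_term c x (of_real s) n" for n
    proof -
      have "of_nat (Suc n) * complex_of_real s = of_real (s * real (Suc n))"
        by simp
      then show ?thesis
        by (simp only: f_def h_def lambert_term_def exp_geometric_of_real)
           (simp add: power2_eq_square del: of_nat_Suc power_Suc)
    qed
    then have "(\<lambda>n. f n s) sums (of_real s * - ln_qpoch c x (of_real s))"
      using sums_mult[OF lambert_term_sums[OF c x]] elim by simp
    then show ?case
      by (simp add: sums_iff)
  qed
  ultimately have "((\<lambda>s. - (of_real s * ln_qpoch c x (of_real s))) \<longlongrightarrow> dilog c) (at_right 0)"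
    by (rule Lim_transform_eventually)
  then show ?thesis
    by (simp add: tendsto_minus_cancel_left)
qed

lemma Ln_one_minus_exp_of_real:
  assumes "t > 0"
  shows "Ln (1 - exp (- of_real t)) = of_real (ln (1 - exp (- t)))"
proof -
  have "1 - exp (- of_real t) = complex_of_real (1 - exp (- t))"
    by (simp flip: exp_of_real)
  then show ?thesis
    using assms by (simp only: Ln_of_real exp_less_one_iff neg_less_0_iff_less diff_gt_0_iff_gt)
qed

lemma ln_qpoch_1_shift:
  assumes "x > 0" "s > 0"
  shows "ln_qpoch 1 x (of_real s) =
    of_real (ln (1 - exp (- (x * s)))) + ln_qpoch 1 (1 + x) (of_real s)"
  using ln_qpoch_shift[of 1 x "of_real s"] Ln_one_minus_exp_of_real[of "x * s"] assms
  by (simp add: add.commute)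

lemma sums_ln_ln_qpoch_1:
  assumes "x > 0" "s > 0"
  shows "(\<lambda>k. complex_of_real (ln (1 - exp (- ((x + real k) * s))))) sums ln_qpoch 1 x (of_real s)"
proof -
  have "complex_of_real (ln (1 - exp (- ((x + real k) * s)))) =
      Ln (1 - 1 * exp (- (of_real (x + real k) * of_real s)))" for k
    using Ln_one_minus_exp_of_real[of "(x + real k) * s"] assms by (simp add: add_pos_nonneg)
  then show ?thesis
    using sums_Ln_ln_qpoch[of 1 x "of_real s"] assms by simp
qed

lemma ln_one_minus_exp_reflection:
  fixes u v :: real
  assumes "\<bar>v\<bar> < u"
  shows "ln (1 - exp (- (u + v))) + ln (1 - exp (- (u - v))) - 2 * ln (1 - exp (- u)) =
    ln (1 - (sinh (v / 2) / sinh (u / 2))\<^sup>2)"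
proof -
  have ln_eq: "ln (1 - exp (- t)) = ln 2 - t / 2 + ln (sinh (t / 2))" if "t > 0" for t :: real
  proof -
    have "exp (- (t / 2)) * exp (t / 2) = 1" "exp (- (t / 2)) * exp (- (t / 2)) = exp (- t)"
      by (simp_all flip: exp_add)
    then have "1 - exp (- t) = 2 * exp (- (t / 2)) * sinh (t / 2)"
      by (simp add: sinh_field_def right_diff_distrib)
    then show ?thesis
      using that by (simp add: ln_mult)
  qed
  have pos: "sinh (u / 2) > 0" "sinh ((u + v) / 2) > 0" "sinh ((u - v) / 2) > 0"
    using assms by auto
  have "sinh ((u + v) / 2) * sinh ((u - v) / 2) =
      (sinh (u / 2))\<^sup>2 * (cosh (v / 2))\<^sup>2 - (cosh (u / 2))\<^sup>2 * (sinh (v / 2))\<^sup>2"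
    by (simp add: add_divide_distrib diff_divide_distrib sinh_add sinh_diff power2_eq_square
        algebra_simps)
  also have "\<dots> = (sinh (u / 2))\<^sup>2 - (sinh (v / 2))\<^sup>2"
    by (simp add: cosh_square_eq algebra_simps)
  also have "\<dots> = (sinh (u / 2))\<^sup>2 * (1 - (sinh (v / 2) / sinh (u / 2))\<^sup>2)"
    using pos(1) by (simp add: power_divide right_diff_distrib)
  finally have product: "sinh ((u + v) / 2) * sinh ((u - v) / 2) / (sinh (u / 2))\<^sup>2 =
      1 - (sinh (v / 2) / sinh (u / 2))\<^sup>2"
    using pos(1) by simp
  have "ln (sinh ((u + v) / 2) * sinh ((u - v) / 2) / (sinh (u / 2))\<^sup>2) =
      ln (sinh ((u + v) / 2)) + ln (sinh ((u - v) / 2)) - 2 * ln (sinh (u / 2))"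
    using pos by (simp add: ln_mult ln_div ln_realpow)
  moreover have "u + v > 0" "u - v > 0" "u > 0"
    using assms by auto
  ultimately show ?thesis
    by (simp only: ln_eq product) (simp add: field_simps)
qed

lemma sinh_dilate_le:
  fixes r u :: real
  assumes r: "0 \<le> r" "r \<le> 1" and u: "u \<ge> 0"
  shows "sinh (r * u) \<le> r * sinh u"
proof -
  have "r * sinh 0 - sinh (r * 0) \<le> r * sinh u - sinh (r * u)"
  proof (rule DERIV_nonneg_imp_nondecreasing[OF u])
    fix t :: real assume "0 \<le> t"
    then have "cosh (r * t) \<le> cosh t"
      using r by (simp add: cosh_real_nonneg_le_iff mult_left_le_one_le)
    then have "r * cosh t - cosh (r * t) * r \<ge> 0"
      using r by (simp add: mult.commute mult_right_mono flip: right_diff_distrib)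
    moreover have "((\<lambda>t. r * sinh t - sinh (r * t)) has_real_derivative
        r * cosh t - cosh (r * t) * r) (at t)"
      by (auto intro!: derivative_eq_intros)
    ultimately show "\<exists>d. ((\<lambda>t. r * sinh t - sinh (r * t)) has_real_derivative d) (at t) \<and> 0 \<le> d"
      by blast
  qed
  then show ?thesis
    by simp
qed

lemma sums_ln_sin_product:
  assumes x: "0 < x" "x < (1::real)"
  shows "(\<lambda>k. ln (1 - (x / real (Suc k))\<^sup>2)) sums ln (sin (pi * x) / (pi * x))"
proof -
  have nonzero: "1 - (x / real k)\<^sup>2 \<noteq> 0" if "k \<ge> 1" for k
  proof -
    have "x / real k < 1"
      using x that by simp
    then have "(x / real k)\<^sup>2 < 1"
      using x by (simp add: power_less_one_iff)
    then show ?thesis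
      by simp
  qed
  have "(\<lambda>n. ln (\<Prod>k=1..n. 1 - x\<^sup>2 / (real k)\<^sup>2)) \<longlonglongrightarrow> ln (sin (pi * x) / (pi * x))"
    using x sin_gt_zero[of "pi * x"] by (intro tendsto_ln sin_product_formula_real') auto
  moreover have "ln (\<Prod>k=1..n. 1 - x\<^sup>2 / (real k)\<^sup>2) = (\<Sum>k<n. ln (1 - (x / real (Suc k))\<^sup>2))" for n
  proof -
    have "ln (\<Prod>k=1..n. 1 - x\<^sup>2 / (real k)\<^sup>2) = (\<Sum>k=1..n. ln (1 - (x / real k)\<^sup>2))"
      unfolding power_divide[symmetric] using nonzero by (intro ln_prod) auto
    also have "\<dots> = (\<Sum>k<n. ln (1 - (x / real (Suc k))\<^sup>2))"
      by (rule sum.reindex_bij_witness[of _ Suc "\<lambda>k. k - 1"]) auto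
    finally show ?thesis .
  qed
  ultimately show ?thesis
    by (simp add: sums_def)
qed

lemma sinh_ratio_power2_le:
  fixes u v :: real
  assumes "0 \<le> v" "v \<le> u" "0 < u"
  shows "(sinh (v / 2) / sinh (u / 2))\<^sup>2 \<le> (v / u)\<^sup>2"
proof -
  have "sinh (v / u * (u / 2)) \<le> v / u * sinh (u / 2)"
    using assms by (intro sinh_dilate_le) auto
  then have "sinh (v / 2) / sinh (u / 2) \<le> v / u"
    using assms by (simp add: divide_le_eq)
  then show ?thesis
    using assms by (intro power_mono) auto
qed

lemma abs_ln_one_minus_le:
  fixes r \<rho> :: real
  assumes "0 \<le> \<rho>" "\<rho> \<le> r" "r < 1"
  shows "\<bar>ln (1 - \<rho>)\<bar> \<le> \<rho> / (1 - r)"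
proof -
  have "\<bar>ln (1 - \<rho>)\<bar> = ln (1 / (1 - \<rho>))"
    using assms by (simp add: ln_div)
  also have "\<dots> \<le> 1 / (1 - \<rho>) - 1"
    using assms by (intro ln_le_minus_one) auto
  also have "\<dots> = \<rho> / (1 - \<rho>)"
    using assms by (simp add: field_simps)
  also have "\<dots> \<le> \<rho> / (1 - r)"
    using assms by (intro divide_left_mono) auto
  finally show ?thesis .
qed

definition ln_sinh_product :: "real \<Rightarrow> real \<Rightarrow> real" where
  "ln_sinh_product x s = (\<Sum>k. ln (1 - (sinh (x * s / 2) / sinh (real (Suc k) * s / 2))\<^sup>2))"

lemma tendsto_ln_sinh_product:
  assumes x: "0 < x" "x < 1"
  shows "(ln_sinh_product x \<longlongrightarrow> ln (sin (pi * x) / (pi * x))) (at_right 0)"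
proof -
  define \<rho> where "\<rho> = (\<lambda>k s. (sinh (x * s / 2) / sinh (real (Suc k) * s / 2))\<^sup>2)"
  have x2: "x\<^sup>2 < 1"
    using x by (simp add: power_less_one_iff)
  have quotient_le: "(x / real (Suc k))\<^sup>2 \<le> x\<^sup>2" for k
    using x by (intro power_mono) (simp_all add: divide_le_eq mult_le_cancel_left1)
  have \<rho>_le: "\<rho> k s \<le> (x / real (Suc k))\<^sup>2" if "s > 0" for k s
  proof -
    have "x * s \<le> real (Suc k) * s"
      using x that by (intro mult_right_mono) auto
    from sinh_ratio_power2_le[OF _ this] show ?thesis
      using x that by (simp add: \<rho>_def del: of_nat_Suc)
  qed
  have bound: "norm (ln (1 - \<rho> k s)) \<le> x\<^sup>2 / (1 - x\<^sup>2) * (1 / real (Suc k) ^ 2)" if "s > 0" for k s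
  proof -
    have "norm (ln (1 - \<rho> k s)) \<le> \<rho> k s / (1 - x\<^sup>2)"
      unfolding real_norm_def
      by (intro abs_ln_one_minus_le order_trans[OF \<rho>_le[OF that] quotient_le] x2) (simp add: \<rho>_def)
    also have "\<dots> \<le> (x / real (Suc k))\<^sup>2 / (1 - x\<^sup>2)"
      using \<rho>_le[OF that] x2 by (intro divide_right_mono) auto
    finally show ?thesis
      by (simp add: power_divide mult.commute)
  qed
  have "((\<lambda>s. \<rho> k s) \<longlongrightarrow> (x / real (Suc k))\<^sup>2) (at_right 0)" for k
    unfolding \<rho>_def using x by real_asymp
  moreover have "1 - (x / real (Suc k))\<^sup>2 \<noteq> 0" for k
    using quotient_le[of k] x2 by linarith
  ultimately have "((\<lambda>s. ln (1 - \<rho> k s)) \<longlongrightarrow> ln (1 - (x / real (Suc k))\<^sup>2)) (at_right 0)" for k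
    by (intro tendsto_intros)
  moreover have "\<forall>\<^sub>F s in at_right 0. \<forall>k.
      norm (ln (1 - \<rho> k s)) \<le> x\<^sup>2 / (1 - x\<^sup>2) * (1 / real (Suc k) ^ 2)"
    using eventually_at_right_less[of 0] by eventually_elim (use bound in blast)
  ultimately have "((\<lambda>s. \<Sum>k. ln (1 - \<rho> k s)) \<longlongrightarrow> (\<Sum>k. ln (1 - (x / real (Suc k))\<^sup>2))) (at_right 0)"
    by (rule tendsto_suminf_dominated[OF _ _ summable_mult[OF summable_inverse_Suc_squares]]) simp
  then show ?thesis
    by (simp only: ln_sinh_product_def[abs_def] \<rho>_def sums_unique[OF sums_ln_sin_product[OF x]])
qed

lemma ln_qpoch_1_reflection:
  assumes x: "0 < x" "x < 1" and s: "s > 0"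
  shows "ln_qpoch 1 (1 + x) (of_real s) + ln_qpoch 1 (1 - x) (of_real s) =
    2 * ln_qpoch 1 1 (of_real s) + of_real (ln_sinh_product x s)"
proof -
  define \<rho> where "\<rho> = (\<lambda>k. (sinh (x * s / 2) / sinh (real (Suc k) * s / 2))\<^sup>2)"
  define f where "f = (\<lambda>y k. complex_of_real (ln (1 - exp (- ((y + real k) * s)))))"
  have summand: "f (1 + x) k + f (1 - x) k - 2 * f 1 k = of_real (ln (1 - \<rho> k))" for k
  proof -
    have "\<bar>x * s\<bar> < real (Suc k) * s"
      using x s mult_strict_right_mono[of x "real (Suc k)" s] by simp
    from ln_one_minus_exp_reflection[OF this]
    have "ln (1 - exp (- ((1 + x + real k) * s))) + ln (1 - exp (- ((1 - x + real k) * s))) -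
        2 * ln (1 - exp (- ((1 + real k) * s))) = ln (1 - \<rho> k)"
      by (simp add: \<rho>_def algebra_simps)
    from arg_cong[OF this, of complex_of_real] show ?thesis
      by (simp add: f_def)
  qed
  define L where "L = (\<lambda>y. ln_qpoch 1 y (of_real s))"
  have "(\<lambda>k. f (1 + x) k + f (1 - x) k - 2 * f 1 k) sums (L (1 + x) + L (1 - x) - 2 * L 1)"
    unfolding L_def f_def using x s by (intro sums_diff sums_add sums_mult sums_ln_ln_qpoch_1) auto
  note product = this[unfolded summand]
  have "complex_of_real (\<Sum>k. ln (1 - \<rho> k)) = L (1 + x) + L (1 - x) - 2 * L 1"
    using sums_summable[OF product] sums_unique[OF product]
    by (simp only: suminf_of_real summable_of_real_iff)
  then show ?thesis
    by (simp add: ln_sinh_product_def \<rho>_def L_def)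
qed

lemma ln_qpoch_1_pair:
  assumes x: "0 < x" "x < 1" and s: "s > 0"
  shows "ln_qpoch 1 x (of_real s) + ln_qpoch 1 (1 - x) (of_real s) =
    2 * ln_qpoch 1 1 (of_real s) + of_real (ln (1 - exp (- (x * s))) + ln_sinh_product x s)"
  using ln_qpoch_1_shift[OF x(1) s] ln_qpoch_1_reflection[OF x s] by simp

text \<open>If \<open>s G s\<close> changes by \<open>o(s)\<close> when \<open>s\<close> is halved, it also changes by \<open>o(s)\<close> in total when
  \<open>s\<close> is halved again and again.\<close>

lemma norm_dyadic_diff_le:
  fixes G :: "real \<Rightarrow> 'a::real_normed_vector"
  assumes small: "\<And>u. 0 < u \<Longrightarrow> u < d \<Longrightarrow> norm (G u - 2 *\<^sub>R G (2 * u)) \<le> e"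
    and s: "0 < s" "s < d"
  shows "norm ((s / 2 ^ n) *\<^sub>R G (s / 2 ^ n) - s *\<^sub>R G s) \<le> e * s * (1 - 1 / 2 ^ n)"
proof (induction n)
  case (Suc n)
  define u where "u = s / 2 ^ Suc n"
  have "u * 1 \<le> u * 2 ^ Suc n"
    unfolding u_def using s by (intro mult_left_mono one_le_power) auto
  then have u: "0 < u" "u < d" "s / 2 ^ n = 2 * u"
    using s by (simp_all add: u_def)
  have "u *\<^sub>R G u - s *\<^sub>R G s = u *\<^sub>R (G u - 2 *\<^sub>R G (2 * u)) + ((2 * u) *\<^sub>R G (2 * u) - s *\<^sub>R G s)"
    by (simp add: algebra_simps)
  also have "norm \<dots> \<le> u * e + e * s * (1 - 1 / 2 ^ n)"
    using small[OF u(1,2)] u Suc by (intro norm_triangle_mono) auto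
  also have "\<dots> = e * s * (1 - 1 / 2 ^ Suc n)"
    by (simp add: u_def field_simps)
  finally show ?case
    by (simp add: u_def)
qed simp

lemma tendsto_minus_pole_of_duplication:
  fixes G :: "real \<Rightarrow> 'a::real_normed_vector"
  assumes duplication: "((\<lambda>s. G s - 2 *\<^sub>R G (2 * s)) \<longlongrightarrow> 0) (at_right 0)"
    and leading: "((\<lambda>s. s *\<^sub>R G s) \<longlongrightarrow> A) (at_right 0)"
  shows "((\<lambda>s. G s - (1 / s) *\<^sub>R A) \<longlongrightarrow> 0) (at_right 0)"
proof (rule tendstoI)
  fix e :: real assume e: "e > 0"
  then have "e / 2 > 0"
    by simp
  from tendstoD[OF duplication this] obtain d where d: "d > 0"
    and small: "\<And>u. 0 < u \<Longrightarrow> u < d \<Longrightarrow> norm (G u - 2 *\<^sub>R G (2 * u)) \<le> e / 2"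
    by (auto simp: eventually_at_right_field intro: less_imp_le)
  have limit_bound: "norm (A - s *\<^sub>R G s) \<le> e / 2 * s" if s: "0 < s" "s < d" for s
  proof (rule tendsto_upperbound)
    have "filterlim (\<lambda>n. s / 2 ^ n) (at_right 0) sequentially"
      using s by real_asymp
    from filterlim_compose[OF leading this]
    show "(\<lambda>n. norm ((s / 2 ^ n) *\<^sub>R G (s / 2 ^ n) - s *\<^sub>R G s)) \<longlonglongrightarrow> norm (A - s *\<^sub>R G s)"
      by (intro tendsto_intros)
    have "e / 2 * s * (1 - 1 / 2 ^ n) \<le> e / 2 * s" for n
      using s e by (simp add: mult_left_le)
    then show "\<forall>\<^sub>F n in sequentially. norm ((s / 2 ^ n) *\<^sub>R G (s / 2 ^ n) - s *\<^sub>R G s) \<le> e / 2 * s"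
      using norm_dyadic_diff_le[of d G "e / 2", OF small s] order_trans
      by (intro always_eventually) blast
  qed simp
  have "\<forall>\<^sub>F s in at_right 0. s < d"
    using d by (simp add: eventually_at_right_field) blast
  then show "\<forall>\<^sub>F s in at_right 0. dist (G s - (1 / s) *\<^sub>R A) 0 < e"
    using eventually_at_right_less[of 0]
  proof eventually_elim
    case (elim s)
    have "G s - (1 / s) *\<^sub>R A = (- (1 / s)) *\<^sub>R (A - s *\<^sub>R G s)"
      using elim by (simp add: algebra_simps)
    then have "norm (G s - (1 / s) *\<^sub>R A) = (1 / s) * norm (A - s *\<^sub>R G s)"
      using elim by simp
    also have "\<dots> \<le> (1 / s) * (e / 2 * s)"
      using limit_bound[of s] elim by (intro mult_left_mono) auto
    also have "\<dots> < e"
      using e elim by simp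
    finally show ?case
      by simp
  qed
qed

lemma ln_qpoch_1_1_duplication:
  assumes s: "s > 0"
  shows "2 * ln_qpoch 1 1 (of_real s) - 4 * ln_qpoch 1 1 (of_real (2 * s)) =
    of_real (ln (1 - exp (- s)) + ln_sinh_product (1/2) (2 * s))"
proof -
  have "ln_qpoch 1 1 (of_real s) =
      ln_qpoch 1 (1/2) (of_real (2 * s)) + ln_qpoch 1 1 (of_real (2 * s))"
    using ln_qpoch_multisection[of 2 1 1 "of_real s"] s by (simp add: numeral_2_eq_2)
  then show ?thesis
    using ln_qpoch_1_pair[of "1/2" "2 * s"] s by simp
qed

lemma tendsto_ln_qpoch_reg_1_1:
  "((\<lambda>s. 2 * ln_qpoch_reg 1 1 s + of_real (ln s)) \<longlongrightarrow> of_real (ln (2 * pi))) (at_right 0)"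
proof -
  define G where "G = (\<lambda>s. 2 * ln_qpoch 1 1 (of_real s) + of_real (ln s - ln (2 * pi)))"
  define E where "E =
    (\<lambda>s. ln_sinh_product (1/2) (2 * s) + (ln (1 - exp (- s)) - ln s - (ln 2 - ln pi)))"
  have "(ln_sinh_product (1/2) \<longlongrightarrow> ln 2 - ln pi) (at_right 0)"
    using tendsto_ln_sinh_product[of "1/2"] by (simp add: ln_div)
  then have "((\<lambda>s. ln_sinh_product (1/2) (2 * s)) \<longlongrightarrow> ln 2 - ln pi) (at_right 0)"
    by (rule filterlim_compose) real_asymp
  moreover have "((\<lambda>s. ln (1 - exp (- s)) - ln s - (ln 2 - ln pi)) \<longlongrightarrow> - (ln 2 - ln pi)) (at_right 0)"
    by real_asymp
  ultimately have "(E \<longlongrightarrow> (ln 2 - ln pi) + - (ln 2 - ln pi)) (at_right 0)"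
    unfolding E_def by (rule tendsto_add)
  from tendsto_of_real[OF this] have "((\<lambda>s. complex_of_real (E s)) \<longlongrightarrow> 0) (at_right 0)"
    by simp
  moreover have "\<forall>\<^sub>F s in at_right 0. complex_of_real (E s) = G s - 2 *\<^sub>R G (2 * s)"
    using eventually_at_right_less[of 0]
  proof eventually_elim
    case (elim s)
    then have "G s - 2 *\<^sub>R G (2 * s) = 2 * ln_qpoch 1 1 (of_real s) -
        4 * ln_qpoch 1 1 (of_real (2 * s)) + of_real (ln pi - ln 2 - ln s)"
      by (simp add: G_def scaleR_conv_of_real ln_mult algebra_simps)
    also have "\<dots> = complex_of_real (E s)"
      unfolding ln_qpoch_1_1_duplication[OF elim] by (simp add: E_def)
    finally show ?case ..
  qed
  ultimately have duplication: "((\<lambda>s. G s - 2 *\<^sub>R G (2 * s)) \<longlongrightarrow> 0) (at_right 0)"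
    by (rule Lim_transform_eventually)
  have "((\<lambda>s. 2 * (of_real s * ln_qpoch 1 1 (of_real s)) + of_real (s * (ln s - ln (2 * pi)))) \<longlongrightarrow>
      2 * - dilog 1 + of_real 0) (at_right 0)"
    by (intro tendsto_intros ln_qpoch_leading_term tendsto_of_real) (auto, real_asymp)
  then have "((\<lambda>s. s *\<^sub>R G s) \<longlongrightarrow> - (2 * dilog 1)) (at_right 0)"
    by (simp add: G_def scaleR_conv_of_real algebra_simps)
  from tendsto_minus_pole_of_duplication[OF duplication this]
  have "((\<lambda>s. G s + (1 / s) *\<^sub>R (2 * dilog 1)) \<longlongrightarrow> 0) (at_right 0)"
    by simp
  from tendsto_add[OF this tendsto_const[of "of_real (ln (2 * pi))"]] show ?thesis
    by (simp add: G_def ln_qpoch_reg_def scaleR_conv_of_real algebra_simps)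
qed

lemma tendsto_ln_qpoch_reg_1_pair:
  assumes x: "0 < x" "x < 1"
  shows "((\<lambda>s. ln_qpoch_reg 1 x s + ln_qpoch_reg 1 (1 - x) s) \<longlongrightarrow>
    of_real (ln (2 * sin (pi * x)))) (at_right 0)"
proof -
  define E where "E = (\<lambda>s. ln_sinh_product x s + (ln (1 - exp (- (x * s))) - ln s))"
  have "((\<lambda>s. ln (1 - exp (- (x * s))) - ln s) \<longlongrightarrow> ln x) (at_right 0)"
    using x by real_asymp
  then have "(E \<longlongrightarrow> ln (sin (pi * x) / (pi * x)) + ln x) (at_right 0)"
    unfolding E_def by (intro tendsto_add tendsto_ln_sinh_product x)
  from tendsto_add[OF tendsto_ln_qpoch_reg_1_1 tendsto_of_real[OF this]]
  have "((\<lambda>s. 2 * ln_qpoch_reg 1 1 s + of_real (ln s) + of_real (E s)) \<longlongrightarrow>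
      of_real (ln (2 * pi) + (ln (sin (pi * x) / (pi * x)) + ln x))) (at_right 0)"
    by simp
  also have "ln (2 * pi) + (ln (sin (pi * x) / (pi * x)) + ln x) = ln (2 * sin (pi * x))"
    using x sin_gt_zero[of "pi * x"] by (simp add: ln_mult ln_div)
  finally show ?thesis
  proof (rule Lim_transform_eventually)
    show "\<forall>\<^sub>F s in at_right 0. 2 * ln_qpoch_reg 1 1 s + of_real (ln s) + of_real (E s) =
        ln_qpoch_reg 1 x s + ln_qpoch_reg 1 (1 - x) s"
      using eventually_at_right_less[of 0]
    proof eventually_elim
      case (elim s)
      show ?case
        using ln_qpoch_1_pair[OF x elim] by (simp add: ln_qpoch_reg_def E_def algebra_simps)
    qed
  qed
qed

section \<open>Finite parts of integrals along vertical lines\<close>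

definition decays_at_cusp :: "(complex \<Rightarrow> complex) \<Rightarrow> bool" where
  "decays_at_cusp F \<longleftrightarrow>
    (\<exists>p>0. \<forall>h>0. \<exists>K\<ge>0. \<forall>\<tau>. h \<le> Im \<tau> \<longrightarrow> norm (F \<tau>) \<le> K * exp (- (p * Im \<tau>)))"

lemma decays_at_cusp_add:
  assumes "decays_at_cusp F" "decays_at_cusp G"
  shows "decays_at_cusp (\<lambda>\<tau>. F \<tau> + G \<tau>)"
proof -
  obtain p where p: "p > 0"
    and F: "\<And>h. h > 0 \<Longrightarrow> \<exists>K\<ge>0. \<forall>\<tau>. h \<le> Im \<tau> \<longrightarrow> norm (F \<tau>) \<le> K * exp (- (p * Im \<tau>))"
    using assms(1) unfolding decays_at_cusp_def by blast
  obtain q where q: "q > 0"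
    and G: "\<And>h. h > 0 \<Longrightarrow> \<exists>K\<ge>0. \<forall>\<tau>. h \<le> Im \<tau> \<longrightarrow> norm (G \<tau>) \<le> K * exp (- (q * Im \<tau>))"
    using assms(2) unfolding decays_at_cusp_def by blast
  have "\<exists>K\<ge>0. \<forall>\<tau>. h \<le> Im \<tau> \<longrightarrow> norm (F \<tau> + G \<tau>) \<le> K * exp (- (min p q * Im \<tau>))" if h: "h > 0" for h
  proof -
    obtain K L where K: "K \<ge> 0" "\<And>\<tau>. h \<le> Im \<tau> \<Longrightarrow> norm (F \<tau>) \<le> K * exp (- (p * Im \<tau>))"
      and L: "L \<ge> 0" "\<And>\<tau>. h \<le> Im \<tau> \<Longrightarrow> norm (G \<tau>) \<le> L * exp (- (q * Im \<tau>))"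
      using F[OF h] G[OF h] by blast
    have "norm (F \<tau> + G \<tau>) \<le> (K + L) * exp (- (min p q * Im \<tau>))" if \<tau>: "h \<le> Im \<tau>" for \<tau>
    proof -
      have "norm (F \<tau> + G \<tau>) \<le> K * exp (- (p * Im \<tau>)) + L * exp (- (q * Im \<tau>))"
        using norm_triangle_mono[OF K(2) L(2)] \<tau> by blast
      also have "\<dots> \<le> K * exp (- (min p q * Im \<tau>)) + L * exp (- (min p q * Im \<tau>))"
        using K(1) L(1) h \<tau> by (intro add_mono mult_left_mono) (auto intro: mult_right_mono)
      finally show ?thesis
        by (simp add: distrib_right)
    qed
    then show ?thesis
      using K(1) L(1) by (intro exI[of _ "K + L"]) auto
  qed
  then show ?thesis
    unfolding decays_at_cusp_def using p q by (intro exI[of _ "min p q"]) auto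
qed

lemma decays_at_cusp_deriv:
  assumes holo: "F holomorphic_on {\<tau>. Im \<tau> > 0}" and "decays_at_cusp F"
  shows "decays_at_cusp (deriv F)"
proof -
  obtain p where p: "p > 0"
    and F: "\<And>h. h > 0 \<Longrightarrow> \<exists>K\<ge>0. \<forall>\<tau>. h \<le> Im \<tau> \<longrightarrow> norm (F \<tau>) \<le> K * exp (- (p * Im \<tau>))"
    using assms(2) unfolding decays_at_cusp_def by blast
  have "\<exists>K\<ge>0. \<forall>\<tau>. 2 * h \<le> Im \<tau> \<longrightarrow> norm (deriv F \<tau>) \<le> K * exp (- (p * Im \<tau>))" if h: "h > 0" for h
  proof -
    obtain K where K: "K \<ge> 0" "\<And>\<tau>. h \<le> Im \<tau> \<Longrightarrow> norm (F \<tau>) \<le> K * exp (- (p * Im \<tau>))"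
      using F[OF h] by blast
    have "norm (deriv F \<tau>) \<le> K * exp (p * h) / h * exp (- (p * Im \<tau>))" if \<tau>: "2 * h \<le> Im \<tau>" for \<tau>
    proof -
      have Im_ge: "Im z \<ge> Im \<tau> - h" if "norm (\<tau> - z) \<le> h" for z
        using abs_Im_le_cmod[of "\<tau> - z"] that by simp
      then have subset: "cball \<tau> h \<subseteq> {\<tau>. Im \<tau> > 0}"
        using \<tau> h by (fastforce simp: dist_norm)
      have "norm ((deriv ^^ 1) F \<tau>) \<le> fact 1 * (K * exp (- (p * (Im \<tau> - h)))) / h ^ 1"
      proof (rule Cauchy_inequality)
        show "F holomorphic_on ball \<tau> h"
          by (rule holomorphic_on_subset[OF holo]) (use subset ball_subset_cball in blast)
        show "continuous_on (cball \<tau> h) F"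
          by (rule holomorphic_on_imp_continuous_on[OF holomorphic_on_subset[OF holo subset]])
        fix z assume z: "norm (\<tau> - z) = h"
        then have "norm (F z) \<le> K * exp (- (p * Im z))"
          using Im_ge[of z] \<tau> by (intro K(2)) auto
        also have "\<dots> \<le> K * exp (- (p * (Im \<tau> - h)))"
          using Im_ge[of z] z K(1) p by (intro mult_left_mono) auto
        finally show "norm (F z) \<le> K * exp (- (p * (Im \<tau> - h)))" .
      qed (rule h)
      also have "exp (- (p * (Im \<tau> - h))) = exp (p * h) * exp (- (p * Im \<tau>))"
        by (simp add: algebra_simps flip: exp_add)
      finally show ?thesis
        by (simp add: mult_ac)
    qed
    then show ?thesis
      using K(1) h by (intro exI[of _ "K * exp (p * h) / h"]) auto
  qed
  from this[of "h / 2" for h] show ?thesis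
    unfolding decays_at_cusp_def using p by (intro exI[of _ p]) auto
qed

lemma absolutely_integrable_on_exp_bound:
  fixes f :: "real \<Rightarrow> 'a::euclidean_space"
  assumes "continuous_on {a..} f" "\<And>t. a \<le> t \<Longrightarrow> norm (f t) \<le> K * exp (- (p * t))" "p > 0"
  shows "f absolutely_integrable_on {a..}"
proof (rule measurable_bounded_by_integrable_imp_absolutely_integrable)
  show "f \<in> borel_measurable (lebesgue_on {a..})"
    using assms(1) by (intro continuous_imp_measurable_on_sets_lebesgue) auto
  show "(\<lambda>t. K * exp (- p * t)) integrable_on {a..}"
    using assms(3) by (intro integrable_on_mult_right integrable_on_exp_minus_to_infinity)
qed (use assms(2) in auto)

lemma integral_atLeast_FTC:
  fixes F :: "real \<Rightarrow> 'a::euclidean_space"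
  assumes deriv: "\<And>t. a \<le> t \<Longrightarrow> (F has_vector_derivative f t) (at t)"
    and int: "f absolutely_integrable_on {a..}" and lim: "(F \<longlongrightarrow> l) at_top"
  shows "integral {a..} f = l - F a"
proof -
  have "((\<lambda>b. set_lebesgue_integral lebesgue {a..b} f) \<longlongrightarrow>
      set_lebesgue_integral lebesgue {a..} f) at_top"
    by (rule tendsto_set_lebesgue_integral_at_top[OF _ int]) auto
  then have "((\<lambda>b. set_lebesgue_integral lebesgue {a..b} f) \<longlongrightarrow> integral {a..} f) at_top"
    by (simp only: set_lebesgue_integral_eq_integral(2)[OF int])
  moreover have "\<forall>\<^sub>F b in at_top. set_lebesgue_integral lebesgue {a..b} f = F b - F a"
    using eventually_ge_at_top[of a]
  proof eventually_elim
    case (elim b)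
    have "f absolutely_integrable_on {a..b}"
      by (rule set_integrable_subset[OF int]) auto
    then have "set_lebesgue_integral lebesgue {a..b} f = integral {a..b} f"
      by (rule set_lebesgue_integral_eq_integral)
    also have "(f has_integral (F b - F a)) {a..b}"
      using elim by (intro fundamental_theorem_of_calculus)
        (auto intro: deriv has_vector_derivative_at_within)
    then have "integral {a..b} f = F b - F a"
      by (rule integral_unique)
    finally show ?case .
  qed
  ultimately have "((\<lambda>b. F b - F a) \<longlongrightarrow> integral {a..} f) at_top"
    by (rule Lim_transform_eventually)
  moreover have "((\<lambda>b. F b - F a) \<longlongrightarrow> l - F a) at_top"
    by (intro tendsto_intros lim)
  ultimately show ?thesis
    by (rule tendsto_unique[OF trivial_limit_at_top_linorder])
qed

lemma decays_at_cusp_vertical: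
  assumes "decays_at_cusp F" "\<epsilon> > 0"
  obtains K p where "p > 0" "\<And>t. \<epsilon> \<le> t \<Longrightarrow> norm (F (of_real r + \<i> * of_real t)) \<le> K * exp (- (p * t))"
proof -
  obtain K p where "p > 0" "\<And>\<tau>. \<epsilon> \<le> Im \<tau> \<Longrightarrow> norm (F \<tau>) \<le> K * exp (- (p * Im \<tau>))"
    using assms unfolding decays_at_cusp_def by blast
  from this(1) this(2)[of "of_real r + \<i> * of_real t" for t] show ?thesis
    by (intro that) auto
qed

lemma absolutely_integrable_vertical_deriv:
  assumes holo: "F holomorphic_on {\<tau>. Im \<tau> > 0}" and decay: "decays_at_cusp F"
    and g: "\<And>\<tau>. Im \<tau> > 0 \<Longrightarrow> g \<tau> = deriv F \<tau>" and \<epsilon>: "\<epsilon> > 0"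
  shows "vertical_pullback g r absolutely_integrable_on {\<epsilon>..}"
proof -
  define path where "path = (\<lambda>t. of_real r + \<i> * of_real t :: complex)"
  have pullback: "vertical_pullback g r t = deriv F (path t) * \<i>" if "\<epsilon> \<le> t" for t
    using that \<epsilon> by (simp add: vertical_pullback_def path_def g)
  have "continuous_on {\<tau>. Im \<tau> > 0} (deriv F)"
    by (intro holomorphic_on_imp_continuous_on holomorphic_deriv holo open_halfspace_Im_gt)
  moreover have "continuous_on {\<epsilon>..} path" "path ` {\<epsilon>..} \<subseteq> {\<tau>. Im \<tau> > 0}"
    unfolding path_def using \<epsilon> by (auto intro!: continuous_intros)
  ultimately have "continuous_on {\<epsilon>..} (\<lambda>t. deriv F (path t) * \<i>)"
    by (rule continuous_on_mult_right[OF continuous_on_compose2])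
  then have "continuous_on {\<epsilon>..} (vertical_pullback g r)"
    by (rule continuous_on_eq) (simp add: pullback)
  moreover obtain K p where "p > 0" "\<And>t. \<epsilon> \<le> t \<Longrightarrow> norm (deriv F (path t)) \<le> K * exp (- (p * t))"
    unfolding path_def
    using decays_at_cusp_vertical[OF decays_at_cusp_deriv[OF holo decay] \<epsilon>] by blast
  ultimately show ?thesis
    by (intro absolutely_integrable_on_exp_bound) (auto simp: pullback norm_mult)
qed

lemma integral_vertical_deriv:
  assumes holo: "F holomorphic_on {\<tau>. Im \<tau> > 0}" and decay: "decays_at_cusp F"
    and g: "\<And>\<tau>. Im \<tau> > 0 \<Longrightarrow> g \<tau> = deriv F \<tau>" and \<epsilon>: "\<epsilon> > 0"
  shows "integral {\<epsilon>..} (vertical_pullback g r) = - F (of_real r + \<i> * of_real \<epsilon>)"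
proof -
  define path where "path = (\<lambda>t. of_real r + \<i> * of_real t :: complex)"
  have "((F \<circ> path) has_vector_derivative vertical_pullback g r t) (at t)" if "\<epsilon> \<le> t" for t
  proof -
    have "(F has_field_derivative deriv F (path t)) (at (path t))"
      using that \<epsilon> by (intro holomorphic_derivI[OF holo open_halfspace_Im_gt]) (auto simp: path_def)
    moreover have "(path has_vector_derivative \<i>) (at t)"
      unfolding path_def by (auto intro!: derivative_eq_intros)
    ultimately have "((F \<circ> path) has_vector_derivative \<i> * deriv F (path t)) (at t)"
      by (rule field_vector_diff_chain_at[rotated])
    then show ?thesis
      using that \<epsilon> by (simp add: vertical_pullback_def path_def g mult.commute)
  qed
  moreover have "((F \<circ> path) \<longlongrightarrow> 0) at_top"
  proof -
    obtain K p where p: "p > 0" and K: "\<And>t. \<epsilon> \<le> t \<Longrightarrow> norm (F (path t)) \<le> K * exp (- (p * t))"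
      unfolding path_def using decays_at_cusp_vertical[OF decay \<epsilon>] by blast
    have "\<forall>\<^sub>F t in at_top. norm ((F \<circ> path) t) \<le> K * exp (- (p * t))"
      using eventually_ge_at_top[of \<epsilon>] by eventually_elim (simp add: K)
    moreover have "((\<lambda>t. K * exp (- (p * t))) \<longlongrightarrow> 0) at_top"
      using p by real_asymp
    ultimately show ?thesis
      by (rule Lim_null_comparison)
  qed
  ultimately have "integral {\<epsilon>..} (vertical_pullback g r) = 0 - (F \<circ> path) \<epsilon>"
    by (intro integral_atLeast_FTC absolutely_integrable_vertical_deriv[OF holo decay g \<epsilon>])
  then show ?thesis
    by (simp add: path_def)
qed

lemma has_fp_integral_simple_pole:
  assumes holo: "F holomorphic_on {\<tau>. Im \<tau> > 0}" and decay: "decays_at_cusp F"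
    and g: "\<And>\<tau>. Im \<tau> > 0 \<Longrightarrow> g \<tau> = deriv F \<tau>"
    and lim: "((\<lambda>t. F (of_real r + \<i> * of_real t) + A / of_real t) \<longlongrightarrow> M) (at_right 0)"
  shows "has_fp_integral (vertical_pullback g r) (- M)"
proof -
  have "((\<lambda>\<epsilon>. integral {\<epsilon>..} (vertical_pullback g r) -
      ((\<Sum>s\<in>{1}. A * of_real (\<epsilon> powr (-s))) + 0 * of_real (ln \<epsilon>))) \<longlongrightarrow> - M) (at_right 0)"
  proof (rule Lim_transform_eventually[OF tendsto_minus[OF lim]])
    show "\<forall>\<^sub>F \<epsilon> in at_right 0. - (F (of_real r + \<i> * of_real \<epsilon>) + A / of_real \<epsilon>) =
        integral {\<epsilon>..} (vertical_pullback g r) -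
        ((\<Sum>s\<in>{1}. A * of_real (\<epsilon> powr (-s))) + 0 * of_real (ln \<epsilon>))"
      using eventually_at_right_less[of 0]
    proof eventually_elim
      case (elim \<epsilon>)
      show ?case
        using integral_vertical_deriv[OF holo decay g elim, of r] elim
        by (simp add: powr_minus divide_inverse)
    qed
  qed
  moreover have "vertical_pullback g r absolutely_integrable_on {\<epsilon>..}" if "\<epsilon> > 0" for \<epsilon>
    by (rule absolutely_integrable_vertical_deriv[OF holo decay g that])
  ultimately show ?thesis
    unfolding has_fp_integral_def
    by (intro conjI allI impI exI[of _ "{1::real}"] exI[of _ "\<lambda>_. A"] exI[of _ 0]) auto
qed

lemma dlog_exp:
  assumes holo: "F holomorphic_on {\<tau>. Im \<tau> > 0}"
    and U: "\<And>\<tau>. Im \<tau> > 0 \<Longrightarrow> U \<tau> = exp (F \<tau>)" and \<tau>: "Im \<tau> > 0"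
  shows "dlog U \<tau> = deriv F \<tau>"
proof -
  have "(F has_field_derivative deriv F \<tau>) (at \<tau>)"
    using \<tau> by (intro holomorphic_derivI[OF holo open_halfspace_Im_gt]) auto
  then have "((\<lambda>\<tau>. exp (F \<tau>)) has_field_derivative exp (F \<tau>) * deriv F \<tau>) (at \<tau>)"
    by (auto intro!: derivative_eq_intros)
  then have "(U has_field_derivative exp (F \<tau>) * deriv F \<tau>) (at \<tau>)"
    by (rule has_field_derivative_transform_within_open[OF _ open_halfspace_Im_gt[of 0]])
       (use U \<tau> in auto)
  then show ?thesis
    using U[OF \<tau>] by (simp add: dlog_def DERIV_imp_deriv)
qed

section \<open>Roots of unity and the function \<open>B\<^sub>1\<close>\<close>

lemma complex_of_real_of_rat: "complex_of_real (of_rat q) = of_rat q"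
  by (induct q) (simp add: of_rat_rat)

lemma zpow_eq_cis: "zpow q = cis (2 * pi * of_rat q)"
  by (simp add: zpow_def cis_conv_exp complex_of_real_of_rat mult_ac)

lemma norm_zpow [simp]: "norm (zpow q) = 1"
  by (simp add: zpow_eq_cis)

lemma zpow_add: "zpow (q + r) = zpow q * zpow r"
  by (simp add: zpow_def of_rat_add ring_distribs exp_add)

lemma zpow_Ints:
  assumes "q \<in> \<int>"
  shows "zpow q = 1"
  using zpow_cong[of q 0] assms by (simp add: zpow_def)

lemma B1_Ints: "q \<in> \<int> \<Longrightarrow> B1 q = 0"
  by (simp add: B1_def)

lemma B1_eq_frac: "q \<notin> \<int> \<Longrightarrow> B1 q = frac q - 1 / 2"
  by (simp add: B1_def frac_def)

lemma B1_unit_interval: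
  assumes "0 < q" "q < 1"
  shows "B1 q = q - 1 / 2"
proof -
  have "q \<notin> \<int>"
    using assms by (auto elim!: Ints_cases)
  then show ?thesis
    using assms by (simp add: B1_eq_frac frac_eq)
qed

lemma B1_add_of_int: "B1 (q + of_int k) = B1 q"
  by (simp add: B1_def)

lemma B1_minus: "B1 (- q) = - B1 q"
  by (cases "q \<in> \<int>") (simp_all add: B1_Ints B1_eq_frac frac_neg)

lemma one_minus_cis: "1 - cis (2 * t) = of_real (2 * sin t) * cis (t - pi / 2)"
  by (simp add: complex_eq_iff cos_double_sin sin_double cos_diff sin_diff power2_eq_square)

lemma norm_one_minus_zpow: "norm (1 - zpow q) = \<bar>2 * sin (pi * of_rat q)\<bar>"
  using one_minus_cis[of "pi * of_rat q"] by (simp add: zpow_eq_cis norm_mult mult_ac)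

lemma norm_one_minus_zpow_minus: "norm (1 - zpow (- q)) = norm (1 - zpow q)"
  by (simp add: norm_one_minus_zpow of_rat_minus)

lemma norm_one_minus_zpow_unit_interval:
  assumes "0 < q" "q < 1"
  shows "norm (1 - zpow q) = 2 * sin (pi * of_rat q)"
proof -
  have "sin (pi * of_rat q) > 0"
    using assms by (intro sin_gt_zero) (simp_all add: of_rat_less_1_iff)
  then show ?thesis
    by (simp add: norm_one_minus_zpow)
qed

lemma zpow_frac: "zpow (frac q) = zpow q"
  by (rule zpow_cong) (simp add: frac_def)

lemma zpow_eq_1_iff: "zpow q = 1 \<longleftrightarrow> q \<in> \<int>"
proof
  assume "zpow q = 1"
  then obtain k :: int where "2 * pi * real_of_rat q = of_int (2 * k) * pi"
    by (auto simp: zpow_def exp_eq_1 simp flip: complex_of_real_of_rat)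
  then have "real_of_rat q = real_of_rat (of_int k)"
    by simp
  then have "q = of_int k"
    by (simp only: of_rat_eq_iff)
  then show "q \<in> \<int>"
    by simp
qed (rule zpow_Ints)

lemma Ln_one_minus_cis:
  assumes "0 < t" "t < pi"
  shows "Ln (1 - cis (2 * t)) = of_real (ln (2 * sin t)) + \<i> * of_real (t - pi / 2)"
proof -
  have "1 - cis (2 * t) = exp (of_real (ln (2 * sin t)) + \<i> * of_real (t - pi / 2))"
    unfolding one_minus_cis exp_add exp_of_real cis_conv_exp[symmetric]
    using sin_gt_zero[OF assms] by simp
  then show ?thesis
    using assms by (simp only:) (rule Ln_exp, auto)
qed

lemma Ln_one_minus_zpow:
  assumes q: "q \<notin> \<int>"
  shows "Ln (1 - zpow q) = of_real (ln (norm (1 - zpow q))) + \<i> * of_real pi * of_rat (B1 q)"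
proof -
  have frac: "0 < frac q" "frac q < 1"
    using q by (simp_all add: frac_lt_1)
  have "zpow (frac q) = cis (2 * (pi * of_rat (frac q)))"
    by (simp add: zpow_eq_cis mult_ac)
  with Ln_one_minus_cis[of "pi * of_rat (frac q)"] frac
  have "Ln (1 - zpow (frac q)) =
      of_real (ln (2 * sin (pi * of_rat (frac q)))) + \<i> * of_real (pi * of_rat (frac q) - pi / 2)"
    by (simp add: of_rat_less_1_iff)
  then have "Ln (1 - zpow (frac q)) =
      of_real (ln (norm (1 - zpow (frac q)))) + \<i> * of_real (pi * of_rat (frac q) - pi / 2)"
    by (simp only: norm_one_minus_zpow_unit_interval[OF frac])
  moreover have "complex_of_real (pi * of_rat (frac q) - pi / 2) = of_real pi * of_rat (B1 q)"
    using q by (simp add: B1_eq_frac of_rat_diff of_rat_divide complex_of_real_of_rat algebra_simps)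
  ultimately show ?thesis
    by (simp add: zpow_frac mult.assoc)
qed

section \<open>Expansions of paired factors\<close>

lemma tendsto_ln_qpoch_reg_zpow_pair:
  assumes x: "0 < x" "x < 1"
  shows "((\<lambda>s. ln_qpoch_reg (zpow q) (of_rat x) s + ln_qpoch_reg (zpow (- q)) (of_rat (1 - x)) s) \<longlongrightarrow>
    of_real (if q \<in> \<int> then ln (norm (1 - zpow x)) else 0) -
      2 * of_real pi * \<i> * of_rat (B1 x * B1 q)) (at_right 0)"
proof (cases "q \<in> \<int>")
  case True
  then have "zpow q = 1" "zpow (- q) = 1" "B1 q = 0"
    by (simp_all add: zpow_Ints B1_Ints)
  with tendsto_ln_qpoch_reg_1_pair[of "of_rat x"] x True show ?thesis
    by (simp add: norm_one_minus_zpow_unit_interval of_rat_diff of_rat_less_1_iff)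
next
  case False
  have "((\<lambda>s. ln_qpoch_reg (zpow q) (of_rat x) s + ln_qpoch_reg (zpow (- q)) (of_rat (1 - x)) s) \<longlongrightarrow>
      of_real (1/2 - of_rat x) * Ln (1 - zpow q) +
      of_real (1/2 - of_rat (1 - x)) * Ln (1 - zpow (- q))) (at_right 0)"
    using x False
    by (intro tendsto_add tendsto_ln_qpoch_reg) (auto simp: zpow_eq_1_iff of_rat_le_1_iff)
  also have "of_real (1/2 - of_rat x) * Ln (1 - zpow q) +
      of_real (1/2 - of_rat (1 - x)) * Ln (1 - zpow (- q)) =
      - (2 * of_real pi * \<i> * (of_rat (x - 1/2) * of_rat (B1 q)))"
    using False
    by (simp add: Ln_one_minus_zpow norm_one_minus_zpow_minus B1_minus of_rat_minus
        of_rat_diff of_rat_divide complex_of_real_of_rat algebra_simps)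
  also have "x - 1/2 = B1 x"
    using x by (simp add: B1_unit_interval)
  finally show ?thesis
    using False by (simp add: of_rat_mult)
qed

lemma tendsto_ln_qpoch_reg_zpow_endpoint:
  assumes q: "q \<notin> \<int>"
  shows "((\<lambda>s. ln_qpoch_reg (zpow q) 1 s + ln_qpoch_reg (zpow (- q)) 1 s) \<longlongrightarrow>
    - of_real (ln (norm (1 - zpow q)))) (at_right 0)"
proof -
  have "((\<lambda>s. ln_qpoch_reg (zpow q) 1 s + ln_qpoch_reg (zpow (- q)) 1 s) \<longlongrightarrow>
      of_real (1/2 - 1) * Ln (1 - zpow q) + of_real (1/2 - 1) * Ln (1 - zpow (- q))) (at_right 0)"
    using q by (intro tendsto_add tendsto_ln_qpoch_reg) (auto simp: zpow_eq_1_iff)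
  also have "of_real (1/2 - 1) * Ln (1 - zpow q) + of_real (1/2 - 1) * Ln (1 - zpow (- q)) =
      - of_real (ln (norm (1 - zpow q)))"
    using q by (simp add: Ln_one_minus_zpow norm_one_minus_zpow_minus B1_minus of_rat_minus
        algebra_simps)
  finally show ?thesis .
qed

section \<open>A logarithm of \<open>u(f)\<close>\<close>

lemma pos_rep_pos: "0 < pos_rep a" and pos_rep_le_1: "pos_rep a \<le> 1"
  unfolding pos_rep_def by linarith+

definition ln_u_factor :: "rat \<Rightarrow> rat \<Rightarrow> complex \<Rightarrow> complex" where
  "ln_u_factor a b \<tau> = ln_qpoch (zpow b) (of_rat (pos_rep a)) (- (2 * of_real pi * \<i> * \<tau>))"

definition ln_u :: "rat \<Rightarrow> rat \<Rightarrow> complex \<Rightarrow> complex" where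
  "ln_u a b \<tau> = ln_u_factor a b \<tau> + ln_u_factor (- a) (- b) \<tau>"

lemma exp_ln_u_factor:
  assumes "Im \<tau> > 0"
  shows "exp (ln_u_factor a b \<tau>) = (\<Prod>n. 1 - qpow (pos_rep a + of_nat n) \<tau> * zpow b)"
proof -
  have factor: "zpow b *
      exp (- (of_real (of_rat (pos_rep a) + real n) * - (2 * of_real pi * \<i> * \<tau>))) =
      qpow (pos_rep a + of_nat n) \<tau> * zpow b" for n
    by (simp add: qpow_def of_rat_add complex_of_real_of_rat mult_ac)
  show ?thesis
    unfolding ln_u_factor_def factor[symmetric] using assms
    by (intro exp_ln_qpoch) (auto simp: pos_rep_pos)
qed

lemma exp_ln_u: "Im \<tau> > 0 \<Longrightarrow> exp (ln_u a b \<tau>) = u_prod a b \<tau>"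
  by (simp add: ln_u_def exp_add exp_ln_u_factor u_prod_def)

lemma holomorphic_ln_u: "ln_u a b holomorphic_on {\<tau>. Im \<tau> > 0}"
proof -
  have "ln_u_factor a b holomorphic_on {\<tau>. Im \<tau> > 0}" for a b
  proof -
    have "ln_qpoch (zpow b) (of_rat (pos_rep a)) \<circ> (\<lambda>\<tau>. - (2 * of_real pi * \<i> * \<tau>))
        holomorphic_on {\<tau>. Im \<tau> > 0}"
      by (rule holomorphic_on_compose_gen[OF _ holomorphic_ln_qpoch])
         (auto intro!: holomorphic_intros simp: pos_rep_pos)
    then show ?thesis
      by (simp add: ln_u_factor_def[abs_def] o_def)
  qed
  then show ?thesis
    unfolding ln_u_def[abs_def] by (intro holomorphic_intros)
qed

lemma decays_at_cusp_ln_u: "decays_at_cusp (ln_u a b)"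
proof -
  have "decays_at_cusp (ln_u_factor a b)" for a b
  proof -
    define x where "x = real_of_rat (pos_rep a)"
    have x: "x > 0"
      by (simp add: x_def pos_rep_pos)
    have "\<exists>K\<ge>0. \<forall>\<tau>. h \<le> Im \<tau> \<longrightarrow> norm (ln_u_factor a b \<tau>) \<le> K * exp (- (2 * pi * x * Im \<tau>))"
      if h: "h > 0" for h
    proof -
      define K where "K = 1 / ((1 - exp (- (2 * pi * h))) * (1 - exp (- (x * (2 * pi * h)))))"
      have "K \<ge> 0"
        using x h by (simp add: K_def)
      moreover have "norm (ln_u_factor a b \<tau>) \<le> K * exp (- (2 * pi * x * Im \<tau>))" if "h \<le> Im \<tau>" for \<tau>
        using norm_ln_qpoch_le[of "zpow b" x "2 * pi * h" "- (2 * of_real pi * \<i> * \<tau>)"] that x h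
        by (simp add: ln_u_factor_def K_def x_def mult_ac)
      ultimately show ?thesis
        by blast
    qed
    then show ?thesis
      unfolding decays_at_cusp_def using x by (intro exI[of _ "2 * pi * x"]) simp
  qed
  then show ?thesis
    unfolding ln_u_def[abs_def] by (intro decays_at_cusp_add)
qed

section \<open>Cosets of the integers in intervals\<close>

definition Ints_coset :: "rat \<Rightarrow> rat set" where
  "Ints_coset a = {y. y - a \<in> \<int>}"

lemma bij_betw_pos_rep_Ints_coset:
  "bij_betw (\<lambda>l. pos_rep a + of_nat l) {..<n} (Ints_coset a \<inter> {0<..of_nat n})"
proof -
  have iff: "pos_rep a + of_nat l \<le> of_nat n \<longleftrightarrow> l < n" for l
  proof
    assume "pos_rep a + of_nat l \<le> of_nat n"
    then have "(of_nat l :: rat) < of_nat n"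
      using pos_rep_pos[of a] by linarith
    then show "l < n"
      by simp
  next
    assume "l < n"
    then have "of_nat (Suc l) \<le> (of_nat n :: rat)"
      by (simp only: of_nat_le_iff Suc_le_eq)
    then show "pos_rep a + of_nat l \<le> of_nat n"
      using pos_rep_le_1[of a] by simp
  qed
  have "inj_on (\<lambda>l. pos_rep a + of_nat l) {..<n}"
    by (simp add: inj_on_def)
  moreover have "(\<lambda>l. pos_rep a + of_nat l) ` {..<n} = Ints_coset a \<inter> {0<..of_nat n}"
  proof -
    have "range (\<lambda>l. pos_rep a + of_nat l) = {y. 0 < y \<and> y - a \<in> \<int>}"
      using bij_betw_pos_rep by (rule bij_betw_imp_surj_on)
    then have "Ints_coset a \<inter> {0<..of_nat n} = range (\<lambda>l. pos_rep a + of_nat l) \<inter> {..of_nat n}"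
      by (auto simp: Ints_coset_def)
    then show ?thesis
      by (auto simp: iff)
  qed
  ultimately show ?thesis
    by (rule bij_betw_imageI)
qed

lemma finite_Ints_coset_greaterThanAtMost: "finite (Ints_coset a \<inter> {0<..of_nat n})"
  using bij_betw_finite[OF bij_betw_pos_rep_Ints_coset] by auto

lemma sum_Ints_coset_greaterThanAtMost:
  assumes "n > 0"
  shows "(\<Sum>y\<in>Ints_coset a \<inter> {0<..of_nat n}. h y) =
    (\<Sum>y\<in>Ints_coset a \<inter> {0<..<of_nat n}. h y) + (if a \<in> \<int> then h (of_nat n) else 0)"
proof -
  have "of_nat n \<in> Ints_coset a \<longleftrightarrow> a \<in> \<int>"
    by (simp add: Ints_coset_def)
  then have "Ints_coset a \<inter> {0<..of_nat n} =
      (Ints_coset a \<inter> {0<..<of_nat n}) \<union> (if a \<in> \<int> then {of_nat n} else {})"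
    using assms by (auto simp: order.order_iff_strict)
  moreover have "finite (Ints_coset a \<inter> {0<..<of_nat n})"
    by (rule finite_subset[OF _ finite_Ints_coset_greaterThanAtMost[of a n]]) auto
  ultimately show ?thesis
    by (simp add: add.commute)
qed

lemma sum_Ints_coset_uminus_greaterThanLessThan:
  "(\<Sum>y\<in>Ints_coset (- a) \<inter> {0<..<of_nat n}. h y) =
    (\<Sum>y\<in>Ints_coset a \<inter> {0<..<of_nat n}. h (of_nat n - y))"
proof (rule sum.reindex_bij_witness[of _ "\<lambda>y. of_nat n - y" "\<lambda>y. of_nat n - y"])
  have reflect: "of_nat n - y \<in> Ints_coset (- a)" if "y \<in> Ints_coset a" for a y
  proof -
    have "of_nat n - (y - a) \<in> \<int>"
      by (rule Ints_diff[OF Ints_of_nat]) (use that in \<open>simp add: Ints_coset_def\<close>)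
    then show ?thesis
      by (simp add: Ints_coset_def algebra_simps)
  qed
  show "of_nat n - y \<in> Ints_coset a \<inter> {0<..<of_nat n}"
    if "y \<in> Ints_coset (- a) \<inter> {0<..<of_nat n}" for y
    using reflect[of y "- a"] that by auto
  show "of_nat n - y \<in> Ints_coset (- a) \<inter> {0<..<of_nat n}"
    if "y \<in> Ints_coset a \<inter> {0<..<of_nat n}" for y
    using reflect[of y a] that by auto
qed auto

lemma pos_rep_eq_self:
  assumes "0 < x" "x \<le> 1"
  shows "pos_rep x = x"
proof -
  have "\<lceil>x\<rceil> = 1"
    using assms by (simp add: ceiling_eq_iff)
  then show ?thesis
    by (simp add: pos_rep_def)
qed

lemma pos_rep_diff_Ints: "pos_rep a - a \<in> \<int>"
  by (simp add: pos_rep_def)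

lemma sum_Ints_coset_periodic:
  fixes h :: "rat \<Rightarrow> 'a::comm_monoid_add"
  assumes n: "n > 0" and periodic: "\<And>y k. h (y + of_int k * of_nat n) = h y"
  shows "(\<Sum>l=0..int n - 1. h (a + of_int l)) = (\<Sum>y\<in>Ints_coset a \<inter> {0<..of_nat n}. h y)"
proof (rule sum.reindex_bij_witness[of _ "\<lambda>y. \<lfloor>y - a\<rfloor> mod int n"
      "\<lambda>l. of_nat n * pos_rep ((a + of_int l) / of_nat n)"])
  fix l assume l: "l \<in> {0..int n - 1}"
  define k where "k = \<lceil>(a + of_int l) / of_nat n\<rceil> - 1"
  have eq: "of_nat n * pos_rep ((a + of_int l) / of_nat n) = a + of_int (l - k * int n)"
    using n by (simp add: pos_rep_def k_def field_simps)
  show "\<lfloor>of_nat n * pos_rep ((a + of_int l) / of_nat n) - a\<rfloor> mod int n = l"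
    unfolding eq add_diff_cancel_left' floor_of_int
    using l mod_mult_self1[of l "- k" "int n"] by simp
  show "of_nat n * pos_rep ((a + of_int l) / of_nat n) \<in> Ints_coset a \<inter> {0<..of_nat n}"
  proof -
    have "of_nat n * pos_rep ((a + of_int l) / of_nat n) \<in> Ints_coset a"
      unfolding eq by (simp add: Ints_coset_def)
    then show ?thesis
      using n pos_rep_pos pos_rep_le_1 by (simp add: mult_left_le)
  qed
  show "h (of_nat n * pos_rep ((a + of_int l) / of_nat n)) = h (a + of_int l)"
    unfolding eq using periodic[of "a + of_int l" "- k"] by (simp add: algebra_simps)
next
  fix y assume y: "y \<in> Ints_coset a \<inter> {0<..of_nat n}"
  then obtain j where j: "y = a + of_int j"
    by (auto simp: Ints_coset_def elim!: Ints_cases) (metis add.commute diff_add_cancel)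
  have "(a + of_int (j mod int n)) / of_nat n - y / of_nat n \<in> \<int>"
  proof -
    have mod: "(of_int (j mod int n) :: rat) = of_int j - of_nat n * of_int (j div int n)"
      by (simp add: minus_mult_div_eq_mod[symmetric])
    have "(a + of_int (j mod int n)) / of_nat n - y / of_nat n = - of_int (j div int n)"
      unfolding mod j using n by (simp add: field_simps)
    then show ?thesis
      by simp
  qed
  then have "pos_rep ((a + of_int (j mod int n)) / of_nat n) = pos_rep (y / of_nat n)"
    by (rule pos_rep_cong)
  also have "\<dots> = y / of_nat n"
    using n y by (intro pos_rep_eq_self) auto
  finally show "of_nat n * pos_rep ((a + of_int (\<lfloor>y - a\<rfloor> mod int n)) / of_nat n) = y"
    using n j by simp
  show "\<lfloor>y - a\<rfloor> mod int n \<in> {0..int n - 1}"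
    using n by simp
qed

text \<open>At \<open>\<tau> = \<alpha>/n + i t\<close>, \<open>q\<^sup>y \<zeta>\<^sup>b\<close> has argument \<open>2\<pi>\<close> times this number.\<close>

definition cusp_angle :: "int \<Rightarrow> nat \<Rightarrow> rat \<Rightarrow> rat \<Rightarrow> rat" where
  "cusp_angle \<alpha> n b y = b + of_int \<alpha> / of_nat n * y"

lemma dedekind_sum_eq_sum_Ints_coset:
  assumes "n > 0"
  shows "dedekind_sum \<alpha> (int n) a b =
    (\<Sum>y\<in>Ints_coset a \<inter> {0<..<of_nat n}. B1 (y / of_nat n) * B1 (cusp_angle \<alpha> n b y))"
proof -
  define h where "h = (\<lambda>y. B1 (y / of_nat n) * B1 (cusp_angle \<alpha> n b y))"
  have "h (y + of_int k * of_nat n) = h y" for y k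
  proof -
    have "(y + of_int k * of_nat n) / of_nat n = y / of_nat n + of_int k"
      "cusp_angle \<alpha> n b (y + of_int k * of_nat n) = cusp_angle \<alpha> n b y + of_int (\<alpha> * k)"
      using assms by (simp_all add: cusp_angle_def field_simps)
    then show ?thesis
      by (simp only: h_def B1_add_of_int)
  qed
  from sum_Ints_coset_periodic[OF assms this, of a] show ?thesis
    using assms
    by (simp add: dedekind_sum_def h_def cusp_angle_def sum_Ints_coset_greaterThanAtMost B1_Ints)
qed

lemma cusp_angle_Ints_iff:
  fixes a b y :: rat
  assumes n: "n > 0" and det: "\<alpha> * d - x * int n = 1" and y: "y \<in> Ints_coset a"
  shows "cusp_angle \<alpha> n b y \<in> \<int> \<longleftrightarrow>
    a * of_int \<alpha> + b * of_nat n \<in> \<int> \<and> y / of_nat n + (a * of_int x + b * of_int d) \<in> \<int>"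
proof -
  define X where "X = y / of_nat n"
  have nX: "y = of_nat n * X"
    using n by (simp add: X_def)
  have det': "of_int \<alpha> * of_int d = (1 + of_int x * of_nat n :: rat)"
    using arg_cong[OF det, of "of_int :: int \<Rightarrow> rat"] by (simp add: algebra_simps)
  have ya: "y - a \<in> \<int>"
    using y by (simp add: Ints_coset_def)
  have A: "a * of_int \<alpha> + b * of_nat n = of_nat n * (b + of_int \<alpha> * X) - of_int \<alpha> * (y - a)"
    by (simp add: nX algebra_simps)
  have B: "X + (a * of_int x + b * of_int d) = of_int d * (b + of_int \<alpha> * X) - of_int x * (y - a)"
    using det' unfolding nX by algebra
  have angle: "b + of_int \<alpha> * X = of_int \<alpha> * (X + (a * of_int x + b * of_int d)) -
      of_int x * (a * of_int \<alpha> + b * of_nat n)"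
    using det' by algebra
  have "b + of_int \<alpha> * X \<in> \<int> \<longleftrightarrow>
      a * of_int \<alpha> + b * of_nat n \<in> \<int> \<and> X + (a * of_int x + b * of_int d) \<in> \<int>"
    using ya by (metis A B angle Ints_diff Ints_mult Ints_of_int Ints_of_nat)
  then show ?thesis
    by (simp add: cusp_angle_def X_def)
qed

lemma mult_pos_rep_in_Ints_coset:
  fixes a b :: rat
  assumes n: "n > 0" and det: "\<alpha> * d - x * int n = 1"
    and A: "a * of_int \<alpha> + b * of_nat n \<in> \<int>"
  shows "of_nat n * pos_rep (- (a * of_int x + b * of_int d)) \<in> Ints_coset a \<inter> {0<..of_nat n}"
proof -
  define B where "B = a * of_int x + b * of_int d"
  have det': "of_int \<alpha> * of_int d = (1 + of_int x * of_nat n :: rat)"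
    using arg_cong[OF det, of "of_int :: int \<Rightarrow> rat"] by (simp add: algebra_simps)
  have "of_nat n * pos_rep (- B) - a =
      of_nat n * (pos_rep (- B) - - B) - of_int d * (a * of_int \<alpha> + b * of_nat n)"
    unfolding B_def using det' by algebra
  then have "of_nat n * pos_rep (- B) - a \<in> \<int>"
    using A pos_rep_diff_Ints[of "- B"] by (simp only: Ints_diff Ints_mult Ints_of_nat Ints_of_int)
  then show ?thesis
    using n pos_rep_pos pos_rep_le_1 by (simp add: Ints_coset_def mult_left_le flip: B_def)
qed

lemma cusp_angle_Ints_iff_eq:
  fixes a b :: rat
  assumes n: "n > 0" and det: "\<alpha> * d - x * int n = 1"
    and A: "a * of_int \<alpha> + b * of_nat n \<in> \<int>" and y: "y \<in> Ints_coset a \<inter> {0<..of_nat n}"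
  shows "cusp_angle \<alpha> n b y \<in> \<int> \<longleftrightarrow>
    y = of_nat n * pos_rep (- (a * of_int x + b * of_int d))"
proof -
  define B where "B = a * of_int x + b * of_int d"
  have "cusp_angle \<alpha> n b y \<in> \<int> \<longleftrightarrow> y / of_nat n + B \<in> \<int>"
    unfolding B_def using cusp_angle_Ints_iff[OF n det] y A by blast
  also have "\<dots> \<longleftrightarrow> y / of_nat n = pos_rep (- B)"
  proof
    assume "y / of_nat n + B \<in> \<int>"
    then have "pos_rep (y / of_nat n) = pos_rep (- B)"
      by (intro pos_rep_cong) simp
    then show "y / of_nat n = pos_rep (- B)"
      using n y by (simp add: pos_rep_eq_self)
  next
    assume "y / of_nat n = pos_rep (- B)"
    then show "y / of_nat n + B \<in> \<int>"
      using pos_rep_diff_Ints[of "- B"] by simp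
  qed
  also have "\<dots> \<longleftrightarrow> y = of_nat n * pos_rep (- B)"
    using n by (auto simp: field_simps)
  finally show ?thesis
    by (simp only: B_def)
qed

lemma sum_ln_one_minus_zpow_greaterThanAtMost:
  assumes n: "n > 0" and det: "\<alpha> * d - x * int n = 1"
  shows "(\<Sum>y\<in>Ints_coset a \<inter> {0<..of_nat n}.
      if cusp_angle \<alpha> n b y \<in> \<int> then ln (norm (1 - zpow (y / of_nat n))) else 0) =
    delta0 (a * of_int \<alpha> + b * of_nat n) * ln (norm (1 - zpow (a * of_int x + b * of_int d)))"
proof (cases "a * of_int \<alpha> + b * of_nat n \<in> \<int>")
  case False
  then show ?thesis
    using cusp_angle_Ints_iff[OF n det] by (intro trans[OF sum.neutral]) (auto simp: delta0_def)
next
  case True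
  define B where "B = a * of_int x + b * of_int d"
  define y0 where "y0 = of_nat n * pos_rep (- B)"
  have "(\<Sum>y\<in>Ints_coset a \<inter> {0<..of_nat n}.
      if cusp_angle \<alpha> n b y \<in> \<int> then ln (norm (1 - zpow (y / of_nat n))) else 0) =
      (\<Sum>y\<in>Ints_coset a \<inter> {0<..of_nat n}. if y = y0 then ln (norm (1 - zpow (y / of_nat n))) else 0)"
    unfolding y0_def B_def
    by (intro sum.cong refl) (simp only: cusp_angle_Ints_iff_eq[OF n det True])
  also have "\<dots> = ln (norm (1 - zpow (y0 / of_nat n)))"
    using mult_pos_rep_in_Ints_coset[OF n det True]
    by (simp add: finite_Ints_coset_greaterThanAtMost y0_def B_def)
  also have "zpow (y0 / of_nat n) = zpow (- B)"
    using n pos_rep_diff_Ints[of "- B"] by (intro zpow_cong) (simp add: y0_def)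
  finally show ?thesis
    using True by (simp add: delta0_def norm_one_minus_zpow_minus flip: B_def)
qed

text \<open>The endpoint \<open>y = n\<close> does not matter because \<open>ln 0 = 0\<close>.\<close>

lemma sum_ln_one_minus_zpow_greaterThanLessThan:
  assumes n: "n > 0" and det: "\<alpha> * d - x * int n = 1"
  shows "(\<Sum>y\<in>Ints_coset a \<inter> {0<..<of_nat n}.
      if cusp_angle \<alpha> n b y \<in> \<int> then ln (norm (1 - zpow (y / of_nat n))) else 0) =
    delta0 (a * of_int \<alpha> + b * of_nat n) * ln (norm (1 - zpow (a * of_int x + b * of_int d)))"
  using n by (simp add: sum_Ints_coset_greaterThanAtMost[OF n] zpow_Ints
      flip: sum_ln_one_minus_zpow_greaterThanAtMost[OF n det])

section \<open>The logarithm at a cusp\<close>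

lemma ln_u_factor_vertical:
  assumes n: "n > 0" and t: "t > 0"
  shows "ln_u_factor a b (of_real (of_int \<alpha> / of_nat n) + \<i> * of_real t) =
    (\<Sum>y\<in>Ints_coset a \<inter> {0<..of_nat n}.
      ln_qpoch (zpow (cusp_angle \<alpha> n b y)) (of_rat (y / of_nat n))
        (of_real (2 * pi * n * t)))"
proof -
  define p where "p = pos_rep a"
  define \<tau> where "\<tau> = of_real (of_int \<alpha> / of_nat n) + \<i> * of_real t"
  define \<phi> where "\<phi> = - (2 * pi * of_int \<alpha>)"
  have \<phi>: "cis \<phi> = 1"
    unfolding \<phi>_def using cis_multiple_2pi[of "- of_int \<alpha>"] by simp
  have w: "of_nat n * - (2 * of_real pi * \<i> * \<tau>) = of_real (2 * pi * n * t) + \<i> * of_real \<phi>"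
    using n by (simp add: \<tau>_def \<phi>_def complex_eq_iff)
  have "ln_u_factor a b \<tau> =
      (\<Sum>l<n. ln_qpoch (zpow b) ((of_rat p + real l) / real n)
        (of_nat n * - (2 * of_real pi * \<i> * \<tau>)))"
    unfolding ln_u_factor_def p_def using n t
    by (intro ln_qpoch_multisection) (auto simp: pos_rep_pos \<tau>_def)
  also have "\<dots> = (\<Sum>l<n. ln_qpoch (zpow (cusp_angle \<alpha> n b (p + of_nat l)))
      (of_rat ((p + of_nat l) / of_nat n)) (of_real (2 * pi * n * t)))"
  proof (intro sum.cong refl)
    fix l
    have x: "(of_rat p + real l) / real n = of_rat ((p + of_nat l) / of_nat n)"
      by (simp add: of_rat_divide of_rat_add)
    have "zpow b * cis (- (of_rat ((p + of_nat l) / of_nat n) * \<phi>)) =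
        zpow (cusp_angle \<alpha> n b (p + of_nat l))"
      unfolding cusp_angle_def zpow_add
      by (simp add: zpow_eq_cis \<phi>_def of_rat_mult of_rat_divide of_rat_add mult_ac)
    then show "ln_qpoch (zpow b) ((of_rat p + real l) / real n)
          (of_nat n * - (2 * of_real pi * \<i> * \<tau>)) =
        ln_qpoch (zpow (cusp_angle \<alpha> n b (p + of_nat l)))
          (of_rat ((p + of_nat l) / of_nat n)) (of_real (2 * pi * n * t))"
      unfolding w x ln_qpoch_add_ii[OF \<phi>] by simp
  qed
  also have "\<dots> = (\<Sum>y\<in>Ints_coset a \<inter> {0<..of_nat n}.
      ln_qpoch (zpow (cusp_angle \<alpha> n b y)) (of_rat (y / of_nat n))
        (of_real (2 * pi * n * t)))"
    unfolding p_def by (rule sum.reindex_bij_betw[OF bij_betw_pos_rep_Ints_coset])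
  finally show ?thesis
    by (simp only: \<tau>_def)
qed

lemma ln_u_vertical:
  fixes a b :: rat and \<alpha> :: int and n :: nat and t :: real
  defines "s \<equiv> complex_of_real (2 * pi * n * t)"
  assumes n: "n > 0" and t: "t > 0"
  shows "ln_u a b (of_real (of_int \<alpha> / of_nat n) + \<i> * of_real t) =
    (\<Sum>y\<in>Ints_coset a \<inter> {0<..<of_nat n}.
      ln_qpoch (zpow (cusp_angle \<alpha> n b y)) (of_rat (y / of_nat n)) s +
      ln_qpoch (zpow (- cusp_angle \<alpha> n b y)) (of_rat (1 - y / of_nat n)) s) +
    (if a \<in> \<int> then ln_qpoch (zpow b) 1 s + ln_qpoch (zpow (- b)) 1 s else 0)"
proof -
  have shift: "zpow (c + of_int \<alpha>) = zpow c" for c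
    by (rule zpow_cong) simp
  have endpoint: "cusp_angle \<alpha> n c (of_nat n) = c + of_int \<alpha>" for c
    using n by (simp add: cusp_angle_def)
  have reflect: "zpow (cusp_angle \<alpha> n (- b) (of_nat n - y)) = zpow (- cusp_angle \<alpha> n b y)"
    "(of_nat n - y) / of_nat n = 1 - y / of_nat n" for y
  proof -
    have "cusp_angle \<alpha> n (- b) (of_nat n - y) = - cusp_angle \<alpha> n b y + of_int \<alpha>"
      using n by (simp add: cusp_angle_def field_simps)
    then show "zpow (cusp_angle \<alpha> n (- b) (of_nat n - y)) = zpow (- cusp_angle \<alpha> n b y)"
      by (simp only: shift)
    show "(of_nat n - y) / of_nat n = 1 - y / of_nat n"
      using n by (simp add: diff_divide_distrib)
  qed
  have "ln_u_factor a b (of_real (of_int \<alpha> / of_nat n) + \<i> * of_real t) =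
      (\<Sum>y\<in>Ints_coset a \<inter> {0<..<of_nat n}.
        ln_qpoch (zpow (cusp_angle \<alpha> n b y)) (of_rat (y / of_nat n)) s) +
      (if a \<in> \<int> then ln_qpoch (zpow b) 1 s else 0)"
    unfolding ln_u_factor_vertical[OF n t] sum_Ints_coset_greaterThanAtMost[OF n] s_def
    using n by (simp add: endpoint shift)
  moreover have "ln_u_factor (- a) (- b) (of_real (of_int \<alpha> / of_nat n) + \<i> * of_real t) =
      (\<Sum>y\<in>Ints_coset a \<inter> {0<..<of_nat n}.
        ln_qpoch (zpow (- cusp_angle \<alpha> n b y)) (of_rat (1 - y / of_nat n)) s) +
      (if a \<in> \<int> then ln_qpoch (zpow (- b)) 1 s else 0)"
    unfolding ln_u_factor_vertical[OF n t] sum_Ints_coset_greaterThanAtMost[OF n]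
      sum_Ints_coset_uminus_greaterThanLessThan reflect s_def
    using n by (simp add: endpoint shift del: uminus_add_conv_diff)
  ultimately show ?thesis
    by (simp add: ln_u_def sum.distrib)
qed

lemma ln_u_paired_asymp:
  fixes a b :: rat and \<alpha> :: int and n :: nat
  assumes ab: "\<not> (a \<in> \<int> \<and> b \<in> \<int>)" and n: "n > 0"
  shows "\<exists>A. ((\<lambda>t. ln_u a b (of_real (of_int \<alpha> / of_nat n) + \<i> * of_real t) + A / of_real t) \<longlongrightarrow>
    of_real ((\<Sum>y\<in>Ints_coset a \<inter> {0<..<of_nat n}.
        if cusp_angle \<alpha> n b y \<in> \<int> then ln (norm (1 - zpow (y / of_nat n))) else 0) -
      delta0 a * ln (norm (1 - zpow b))) -
    2 * of_real pi * \<i> * of_rat (\<Sum>y\<in>Ints_coset a \<inter> {0<..<of_nat n}.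
        B1 (y / of_nat n) * B1 (cusp_angle \<alpha> n b y)))
    (at_right 0)" (is "\<exists>A. (_ \<longlongrightarrow> ?M) _")
proof -
  define Y where "Y = Ints_coset a \<inter> {0<..<of_nat n}"
  define D where "D =
    (\<Sum>y\<in>Y. dilog (zpow (cusp_angle \<alpha> n b y)) + dilog (zpow (- cusp_angle \<alpha> n b y))) +
    (if a \<in> \<int> then dilog (zpow b) + dilog (zpow (- b)) else 0)"
  define pair where "pair = (\<lambda>y s.
    ln_qpoch_reg (zpow (cusp_angle \<alpha> n b y)) (of_rat (y / of_nat n)) s +
    ln_qpoch_reg (zpow (- cusp_angle \<alpha> n b y)) (of_rat (1 - y / of_nat n)) s)"
  define endpoint where "endpoint =
    (\<lambda>s. if a \<in> \<int> then ln_qpoch_reg (zpow b) 1 s + ln_qpoch_reg (zpow (- b)) 1 s else 0)"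
  have pair_lim: "((\<lambda>s. \<Sum>y\<in>Y. pair y s) \<longlongrightarrow>
      (\<Sum>y\<in>Y. of_real (if cusp_angle \<alpha> n b y \<in> \<int> then ln (norm (1 - zpow (y / of_nat n))) else 0) -
        2 * of_real pi * \<i> * of_rat (B1 (y / of_nat n) * B1 (cusp_angle \<alpha> n b y)))) (at_right 0)"
    (is "(_ \<longlongrightarrow> ?P) _")
    unfolding pair_def using n
    by (intro tendsto_sum tendsto_ln_qpoch_reg_zpow_pair) (auto simp: Y_def)
  have endpoint_lim: "(endpoint \<longlongrightarrow> - of_real (delta0 a * ln (norm (1 - zpow b)))) (at_right 0)"
    using tendsto_ln_qpoch_reg_zpow_endpoint[of b] ab by (auto simp: endpoint_def delta0_def)
  have "filterlim (\<lambda>t. 2 * pi * n * t) (at_right 0) (at_right 0)"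
    using n by real_asymp
  from filterlim_compose[OF tendsto_add[OF pair_lim endpoint_lim] this]
  have "((\<lambda>t. (\<Sum>y\<in>Y. pair y (2 * pi * n * t)) + endpoint (2 * pi * n * t)) \<longlongrightarrow>
      ?P + - of_real (delta0 a * ln (norm (1 - zpow b)))) (at_right 0)" .
  also have "?P + - of_real (delta0 a * ln (norm (1 - zpow b))) = ?M"
    by (simp add: Y_def sum_subtractf sum_distrib_left of_rat_sum)
  finally have "((\<lambda>t. (\<Sum>y\<in>Y. pair y (2 * pi * n * t)) + endpoint (2 * pi * n * t)) \<longlongrightarrow> ?M)
      (at_right 0)" .
  moreover have "\<forall>\<^sub>F t in at_right 0. (\<Sum>y\<in>Y. pair y (2 * pi * n * t)) + endpoint (2 * pi * n * t) =
      ln_u a b (of_real (of_int \<alpha> / of_nat n) + \<i> * of_real t) +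
      (D / of_real (2 * pi * n)) / of_real t"
    using eventually_at_right_less[of 0]
  proof eventually_elim
    case (elim t)
    show ?case
      unfolding ln_u_vertical[OF n elim] pair_def endpoint_def D_def
      by (simp add: ln_qpoch_reg_def Y_def sum.distrib add_divide_distrib
          flip: sum_divide_distrib)
  qed
  ultimately show ?thesis
    by (blast intro: Lim_transform_eventually)
qed

lemma ln_u_asymp:
  fixes a b :: rat and \<alpha> x d :: int and n :: nat
  assumes ab: "\<not> (a \<in> \<int> \<and> b \<in> \<int>)" and n: "n > 0" and det: "\<alpha> * d - x * int n = 1"
  shows "\<exists>A. ((\<lambda>t. ln_u a b (of_real (of_int \<alpha> / of_nat n) + \<i> * of_real t) + A / of_real t) \<longlongrightarrow>
    of_real (delta0 (a * of_int \<alpha> + b * of_nat n) *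
        ln (norm (1 - zpow (a * of_int x + b * of_int d))) -
      delta0 a * ln (norm (1 - zpow b))) -
    2 * of_real pi * \<i> * of_rat (dedekind_sum \<alpha> (int n) a b)) (at_right 0)"
  unfolding dedekind_sum_eq_sum_Ints_coset[OF n]
    sum_ln_one_minus_zpow_greaterThanLessThan[OF n det, symmetric]
  by (rule ln_u_paired_asymp[OF ab n])

theorem mainTheorem3:
  fixes a b :: rat and \<alpha> \<beta> x y :: int and f :: "rat \<times> rat \<Rightarrow> int"
  assumes "\<not> (a \<in> \<int> \<and> b \<in> \<int>)"
    and "f = coset_fun (a, b)"
    and "\<alpha> * y - x * \<beta> = 1"
    and "\<beta> > 0"
  shows "fp_integrable (vertical_pullback (dlog (u f)) (of_int \<alpha> / of_int \<beta>)) \<and>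
    1 / (2 * of_real pi * \<i>) *
      fp_integral (vertical_pullback (dlog (u f)) (of_int \<alpha> / of_int \<beta>)) =
    of_rat (dedekind_sum \<alpha> \<beta> a b) -
      1 / (2 * of_real pi * \<i>) *
        of_real (delta0_RClog (slash f \<alpha> x \<beta> y) - delta0_RClog f)"
proof -
  define n where "n = nat \<beta>"
  have n: "n > 0" "\<beta> = int n"
    using assms(4) by (simp_all add: n_def)
  define \<Delta> where "\<Delta> = delta0_RClog (slash f \<alpha> x \<beta> y) - delta0_RClog f"
  define S where "S = complex_of_rat (dedekind_sum \<alpha> \<beta> a b)"
  have \<Delta>: "\<Delta> = delta0 (a * of_int \<alpha> + b * of_nat n) *
        ln (norm (1 - zpow (a * of_int x + b * of_int y))) -
      delta0 a * ln (norm (1 - zpow b))"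
    unfolding \<Delta>_def assms(2) slash_coset_fun[OF assms(3)] delta0_RClog_coset_fun
    by (simp add: n(2))
  obtain A where "((\<lambda>t. ln_u a b (of_real (of_int \<alpha> / of_int \<beta>) + \<i> * of_real t) + A / of_real t) \<longlongrightarrow>
      of_real \<Delta> - 2 * of_real pi * \<i> * S) (at_right 0)"
    using ln_u_asymp[OF assms(1) n(1) assms(3)[unfolded n(2)]] by (auto simp: \<Delta> S_def n(2))
  moreover have "dlog (u f) \<tau> = deriv (ln_u a b) \<tau>" if "Im \<tau> > 0" for \<tau>
    using that by (intro dlog_exp holomorphic_ln_u) (simp_all add: assms(2) u_coset_fun exp_ln_u)
  ultimately have fp: "has_fp_integral (vertical_pullback (dlog (u f)) (of_int \<alpha> / of_int \<beta>))
      (- (of_real \<Delta> - 2 * of_real pi * \<i> * S))"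
    by (intro has_fp_integral_simple_pole[OF holomorphic_ln_u decays_at_cusp_ln_u])
  then show ?thesis
    unfolding fp_integral_eqI[OF fp] fp_integrable_def \<Delta>_def[symmetric] S_def[symmetric]
    by (auto simp: field_simps)
qed

end
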